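(* Let $A=(\mathbb{K}\langle\underline x\rangle,S,I,\prec)$ be a PBW-reduction-algebra over a field $\mathbb{K}$, $\mathbf{w}\in\mathbb{N}_{>0}^n$ a weight vector on $A$, $E$ a finite set, $\prec^E$ an ordering on $A^E$ (not necessarily a well-ordering), $M'\subseteq\mathbb{K}[\underline x]^E$ a finite set, and $M\subseteq A^E$ the left $A$-submodule generated by $\overline{M'}$. If the set $G\subseteq(A^{\mathbf{w}})^E$ is a Gröbner basis with respect to $(\prec^E)^{\mathbf{w}}$ of the left $A^{\mathbf{w}}$-submodule generated by $\overline{h_{\mathbf{w}}(M')}$ and consists of $(1,\mathbf{w})$-homogeneous elements, then $d_h(\tau_{(\prec^E)^{\mathbf{w}}}(G))$ induces a Gröbner basis of $M$ with respect to $\prec^E$. The analogous statement holds for two-sided modules: if $M\subseteq A^E$ is the two-sided submodule generated by $\overline{M'}$ and $G$ is a (left) Gröbner basis, consisting of $(1,\mathbf{w})$-homogeneous elements, with respect to $(\prec^E)^{\mathbf{w}}$ of the two-sided submodule of $(A^{\mathbf{w}})^E$ generated by $\overline{h_{\mathbf{w}}(M')}$, then $d_h(\tau_{(\prec^E)^{\mathbf{w}}}(G))$ induces a Gröbner basis of $M$ with respect to $\prec^E$.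
   Context: **Orderings and PBW-reduction-algebras.** $\mathbb{K}\langle\underline x\rangle=\mathbb{K}\langle x_1,\dots,x_n\rangle$ is the free algebra; $\mathbb{K}[\underline x]$ is viewed as its $\mathbb{K}$-subspace spanned by the standard monomials $\underline x^\alpha=x_1^{\alpha_1}\cdots x_n^{\alpha_n}$. For finite $E$, $R^E=\bigoplus_{e\in E}R(e)$. A monomial ordering $\prec^E$ on $\{\underline x^\alpha(e)\}$ is a total order with $\underline x^\alpha(e)\prec\underline x^{\alpha'}(e')\Rightarrow\underline x^{\alpha+\gamma}(e)\prec\underline x^{\alpha'+\gamma}(e')$; it is a well-ordering if $(e)\preceq\underline x^\alpha(e)$ always. It induces $\prec^E_e$ on $\{\underline x^\alpha\}$ by comparing $\underline x^\alpha(e)$. For $0\ne t\in\mathbb{K}[\underline x]^E$ with largest monomial $\underline x^\alpha(e)$: $\operatorname{lm}(t)=\underline x^\alpha(e)$, $\operatorname{le}(t)=\alpha$, $\operatorname{lcomp}(t)=e$, $\operatorname{lec}(t)=(\alpha,e)$; $\beta+(\alpha,e)=(\alpha+\beta,e)$; leading exponents of $0$ are smaller than all others and absorb addition. A commutation system $(S,\prec)$ is a monomial ordering $\prec$ on $\{\underline x^\alpha\}$ and $S=\{x_jx_i-c_{ij}x_ix_j-d_{ij}\mid i<j\}$, $c_{ij}\in\mathbb{K}^*$, $d_{ij}\in\mathbb{K}[\underline x]$, $d_{ij}=0$ or $\operatorname{lm}(d_{ij})\prec x_ix_j$, such that every element of $\mathbb{K}\langle\underline x\rangle$ is transformed into one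 of $\mathbb{K}[\underline x]$ by finitely many $\mathbb{K}$-linear replacements of a monomial $m\,x_jx_i\,m'$ by $m(c_{ij}x_ix_j+d_{ij})m'$. With $\operatorname{l}_\prec(G)$ the set of leading exponents of nonzero elements of $G$ and $\operatorname{L}_\prec(G)=\operatorname{l}_\prec(G)+\mathbb{N}^n$, a PBW-reduction datum $(\mathbb{K}\langle\underline x\rangle,S,I,\prec)$ is a commutation system with $\prec$ a well-ordering and a finite $I\subseteq\mathbb{K}[\underline x]$ with $\operatorname{L}_\prec(I)=\operatorname{l}_\prec(\langle I\cup S\rangle\cap\mathbb{K}[\underline x])$; the PBW-reduction-algebra is $A=\mathbb{K}\langle\underline x\rangle/\langle I\cup S\rangle$. An ordering $\prec^E$ on $A^E$ is a monomial ordering such that every $(S,\prec^E_e)$ is a commutation system. **Homogenization.** For $\mathbf{w}\in\mathbb{N}^n$, $\deg_{\mathbf{w}}$ gives $x_i$ degree $\mathbf{w}_i$ and $(e)$ degree $0$. $\mathbf{w}$ is a weight vector on $A$ if $\deg_{\mathbf{w}}(d_{ij})\le\deg_{\mathbf{w}}(x_ix_j)$ for all $i<j$. For $0\ne p=\sum_mp_mm\in\mathbb{K}\langle\underline x\rangle^E$ ($m$ monomials), $h_{\mathbf{w}}(p)=\sum_mp_mh^{\deg_{\mathbf{w}}(p)-\deg_{\mathbf{w}}(m)}m\in\mathbb{K}\langle h,\underline x\rangle^E$, $h_{\mathbf{w}}(0)=0$. $A^{\mathbf{w}}=\mathbb{K}\langle h,\underline x\rangle/\langle h_{\mathbf{w}}(\langle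 S\cup I\rangle)\cup\{hx_i-x_ih\mid 1\le i\le n\}\rangle$, graded by $(1,\mathbf{w})$ ($h$ of degree $1$). $(\prec^E)^{\mathbf{w}}$: $h^\alpha\underline x^\beta(e)$ is smaller than $h^{\alpha'}\underline x^{\beta'}(e')$ iff $\alpha+\langle\mathbf{w},\beta\rangle<\alpha'+\langle\mathbf{w},\beta'\rangle$, or equality and $\underline x^\beta(e)\prec^E\underline x^{\beta'}(e')$. $d_h$ is the dehomogenization: the algebra map $h\mapsto1$, $x_i\mapsto x_i$, applied componentwise. Since $\mathbf{w}$ is strictly positive, $(\prec^E)^{\mathbf{w}}$ is a well-ordering and, with $S^{\mathbf{w}}=h_{\mathbf{w}}(S)\cup\{x_ih-hx_i\}$, there are finite sets $I^{\mathbf{w}}_e$ of $(1,\mathbf{w})$-homogeneous elements such that $(\mathbb{K}\langle h,\underline x\rangle,S^{\mathbf{w}},I_e^{\mathbf{w}},(\prec^E)^{\mathbf{w}}_e)$ is a PBW-reduction datum of $A^{\mathbf{w}}$ for each $e$. $\tau_{(\prec^E)^{\mathbf{w}}}(a)\in\mathbb{K}[h,\underline x]^E$ is the unique representative of $a\in(A^{\mathbf{w}})^E$ whose $e$-component is a $\mathbb{K}$-combination of standard monomials $h^\alpha\underline x^\beta$ with $(\alpha,\beta)\notin\operatorname{L}(I_e^{\mathbf{w}})$. **Gröbner bases.** For the well-ordering $(\prec^E)^{\mathbf{w}}$: leading data of $a\in(A^{\mathbf{w}})^E$ are those of $\tau_{(\prec^E)^{\mathbf{w}}}(a)$ (similarly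 for coefficients in $A^{\mathbf{w}}$, with respect to the datum for $e$); a finite subset $G$ of a submodule $N$ is a Gröbner basis of $N$ if each $m\in N$ can be written $m=\sum_{g\in G}a_gg$ with $\operatorname{le}_{\operatorname{lcomp}(g)}(a_g)+\operatorname{lec}(g)\preceq\operatorname{lec}(m)$ for all $g$, where $\operatorname{le}_e$ is with respect to $(\prec^E)^{\mathbf{w}}_e$. For an arbitrary ordering $\prec^E$ on $A^E$: a finite set $H\subseteq\mathbb{K}[\underline x]^E$ with $\overline H\subseteq M$ induces a Gröbner basis of $M$ with respect to $\prec^E$ if for every $t\in\mathbb{K}[\underline x]^E$ with $\overline t\in M$ there are $a_h\in\mathbb{K}[\underline x]$ ($h\in H$) with $\overline t=\sum_{h\in H}\overline{a_h}\,\overline h$ and $\operatorname{le}_{\prec^E_{\operatorname{lcomp}(h)}}(a_h)+\operatorname{lec}_{\prec^E}(h)\preceq^E\operatorname{lec}_{\prec^E}(t)$ for all $h$. *)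

theory Defs
  imports
    "HOL-Library.Poly_Mapping"
    "HOL-Library.Option_ord"
    "HOL-Algebra.Module"
    "HOL-Algebra.QuotRing"
begin

section \<open>The free algebra and its standard monomials\<close>

text \<open>
  Words form a monoid under concatenation, so finitely supported functions from words to a field
  with the convolution product of \<^theory>\<open>HOL-Library.Poly_Mapping\<close> are the free algebra. The
  variables are indexed by a finite linearly ordered type, whose order is the order
  of \<open>x\<^sub>1, \<dots>, x\<^sub>n\<close>. The extra variable \<open>h\<close> is the element \<^term>\<open>None\<close> of the option type over
  the variables, which \<^theory>\<open>HOL-Library.Option_ord\<close> makes the smallest one.
\<close>

instantiation list :: (type) monoid_add
begin

definition zero_list :: "'a list" where "zero_list = []"

definition plus_list :: "'a list \<Rightarrow> 'a list \<Rightarrow> 'a list" where "plus_list = (@)"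

instance by standard (simp_all add: zero_list_def plus_list_def)

end

type_synonym ('v, 'k) ncpoly = "'v list \<Rightarrow>\<^sub>0 'k"
type_synonym 'v expo = "'v \<Rightarrow>\<^sub>0 nat"

definition free_alg :: "('v, 'k::field) ncpoly ring" where
  "free_alg = \<lparr>carrier = UNIV, mult = (*), one = 1, zero = 0, add = (+)\<rparr>"

definition word :: "'v list \<Rightarrow> ('v, 'k::field) ncpoly" where
  "word m = Poly_Mapping.single m 1"

definition scal :: "'k::field \<Rightarrow> ('v, 'k) ncpoly" where
  "scal k = Poly_Mapping.single [] k"

definition std_word :: "'v::{finite,linorder} expo \<Rightarrow> 'v list" where
  "std_word \<alpha> = concat (map (\<lambda>i. replicate (Poly_Mapping.lookup \<alpha> i) i) (sorted_list_of_set UNIV))"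

definition std_polys :: "('v::{finite,linorder}, 'k::field) ncpoly set" where
  "std_polys = {p. Poly_Mapping.keys p \<subseteq> range std_word}"

section \<open>Monomial orderings and leading data\<close>

text \<open>
  An ordering is given by its strict part: on exponents for the monomials of the algebra, on pairs
  of an exponent and a component for those of the free module. Elements of the free
  module of a ring with carrier \<open>R\<close> over \<open>E\<close> are the members of \<open>E \<rightarrow>\<^sub>E R\<close>.
\<close>

definition monomial_order :: "('v expo \<Rightarrow> 'v expo \<Rightarrow> bool) \<Rightarrow> bool" where
  "monomial_order lt \<longleftrightarrow> irreflp lt \<and> transp lt \<and> totalp lt \<and>
     (\<forall>\<alpha> \<beta> \<gamma>. lt \<alpha> \<beta> \<longrightarrow> lt (\<alpha> + \<gamma>) (\<beta> + \<gamma>))"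

definition well_order_cond :: "('v expo \<Rightarrow> 'v expo \<Rightarrow> bool) \<Rightarrow> bool" where
  "well_order_cond lt \<longleftrightarrow> (\<forall>\<alpha>. \<alpha> = 0 \<or> lt 0 \<alpha>)"

definition module_monomial_order ::
    "'e set \<Rightarrow> ('v expo \<times> 'e \<Rightarrow> 'v expo \<times> 'e \<Rightarrow> bool) \<Rightarrow> bool" where
  "module_monomial_order E lt \<longleftrightarrow>
     irreflp_on (UNIV \<times> E) lt \<and> transp_on (UNIV \<times> E) lt \<and> totalp_on (UNIV \<times> E) lt \<and>
     (\<forall>\<alpha> \<alpha>' \<gamma>. \<forall>e\<in>E. \<forall>e'\<in>E. lt (\<alpha>, e) (\<alpha>', e') \<longrightarrow> lt (\<alpha> + \<gamma>, e) (\<alpha>' + \<gamma>, e'))"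

definition comp_order ::
    "('v expo \<times> 'e \<Rightarrow> 'v expo \<times> 'e \<Rightarrow> bool) \<Rightarrow> 'e \<Rightarrow> 'v expo \<Rightarrow> 'v expo \<Rightarrow> bool" where
  "comp_order lt e = (\<lambda>\<alpha> \<beta>. lt (\<alpha>, e) (\<beta>, e))"

definition supp :: "('v::{finite,linorder}, 'k::field) ncpoly \<Rightarrow> 'v expo set" where
  "supp p = {\<alpha>. Poly_Mapping.lookup p (std_word \<alpha>) \<noteq> 0}"

definition msupp ::
    "'e set \<Rightarrow> ('e \<Rightarrow> ('v::{finite,linorder}, 'k::field) ncpoly) \<Rightarrow> ('v expo \<times> 'e) set" where
  "msupp E t = {(\<alpha>, e). e \<in> E \<and> \<alpha> \<in> supp (t e)}"

definition largest :: "('a \<Rightarrow> 'a \<Rightarrow> bool) \<Rightarrow> 'a set \<Rightarrow> 'a option" where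
  "largest lt X = (if X = {} then None else Some (THE x. x \<in> X \<and> (\<forall>y\<in>X. y = x \<or> lt y x)))"

text \<open>
  The leading exponents of \<open>0\<close> are \<^term>\<open>None\<close>; it is below everything and absorbs addition.
\<close>

definition lexp :: "('v expo \<Rightarrow> 'v expo \<Rightarrow> bool) \<Rightarrow> ('v::{finite,linorder}, 'k::field) ncpoly
    \<Rightarrow> 'v expo option" where
  "lexp lt p = largest lt (supp p)"

definition lec :: "('v expo \<times> 'e \<Rightarrow> 'v expo \<times> 'e \<Rightarrow> bool) \<Rightarrow> 'e set
    \<Rightarrow> ('e \<Rightarrow> ('v::{finite,linorder}, 'k::field) ncpoly) \<Rightarrow> ('v expo \<times> 'e) option" where
  "lec lt E t = largest lt (msupp E t)"

text \<open>For \<open>t = 0\<close> the value is irrelevant, since it is only used in sums with \<^term>\<open>lec lt E t\<close>.\<close>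

definition lcomp :: "('v expo \<times> 'e \<Rightarrow> 'v expo \<times> 'e \<Rightarrow> bool) \<Rightarrow> 'e set
    \<Rightarrow> ('e \<Rightarrow> ('v::{finite,linorder}, 'k::field) ncpoly) \<Rightarrow> 'e" where
  "lcomp lt E t = snd (the (lec lt E t))"

fun shift :: "'v expo option \<Rightarrow> ('v expo \<times> 'e) option \<Rightarrow> ('v expo \<times> 'e) option" where
  "shift (Some \<beta>) (Some (\<alpha>, e)) = Some (\<alpha> + \<beta>, e)"
| "shift None _ = None"
| "shift _ None = None"

fun lec_le :: "('a \<Rightarrow> 'a \<Rightarrow> bool) \<Rightarrow> 'a option \<Rightarrow> 'a option \<Rightarrow> bool" where
  "lec_le lt None _ = True"
| "lec_le lt (Some x) None = False"
| "lec_le lt (Some x) (Some y) = (x = y \<or> lt x y)"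

definition lexps :: "('v expo \<Rightarrow> 'v expo \<Rightarrow> bool) \<Rightarrow> ('v::{finite,linorder}, 'k::field) ncpoly set
    \<Rightarrow> 'v expo set" where
  "lexps lt Q = {\<alpha>. \<exists>p\<in>Q. lexp lt p = Some \<alpha>}"

definition Lexps :: "('v expo \<Rightarrow> 'v expo \<Rightarrow> bool) \<Rightarrow> ('v::{finite,linorder}, 'k::field) ncpoly set
    \<Rightarrow> 'v expo set" where
  "Lexps lt Q = {\<alpha> + \<gamma> | \<alpha> \<gamma>. \<alpha> \<in> lexps lt Q}"

section \<open>Commutation systems and PBW-reduction data\<close>

text \<open>
  A set of relations \<open>S\<close> is presented by its coefficients \<open>c i j\<close> and tails \<open>d i j\<close>, of which only
  those with \<open>i < j\<close> are used.
\<close>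

definition relations :: "('v::{finite,linorder} \<Rightarrow> 'v \<Rightarrow> 'k::field)
    \<Rightarrow> ('v \<Rightarrow> 'v \<Rightarrow> ('v, 'k) ncpoly) \<Rightarrow> ('v, 'k) ncpoly set" where
  "relations c d = {word [j, i] - scal (c i j) * word [i, j] - d i j | i j. i < j}"

definition replacement :: "('v::{finite,linorder} \<Rightarrow> 'v \<Rightarrow> 'k::field)
    \<Rightarrow> ('v \<Rightarrow> 'v \<Rightarrow> ('v, 'k) ncpoly) \<Rightarrow> ('v, 'k) ncpoly \<Rightarrow> ('v, 'k) ncpoly \<Rightarrow> bool" where
  "replacement c d p q \<longleftrightarrow> (\<exists>m m' i j. i < j \<and>
     (let k = Poly_Mapping.lookup p (m @ [j, i] @ m') in
      q = p - scal k * word (m @ [j, i] @ m')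
            + scal k * (word m * (scal (c i j) * word [i, j] + d i j) * word m')))"

definition commutation_system :: "('v::{finite,linorder} \<Rightarrow> 'v \<Rightarrow> 'k::field)
    \<Rightarrow> ('v \<Rightarrow> 'v \<Rightarrow> ('v, 'k) ncpoly) \<Rightarrow> ('v expo \<Rightarrow> 'v expo \<Rightarrow> bool) \<Rightarrow> bool" where
  "commutation_system c d lt \<longleftrightarrow> monomial_order lt \<and>
     (\<forall>i j. i < j \<longrightarrow> c i j \<noteq> 0 \<and> d i j \<in> std_polys \<and>
        (\<forall>\<alpha>. lexp lt (d i j) = Some \<alpha> \<longrightarrow>
           lt \<alpha> (Poly_Mapping.single i 1 + Poly_Mapping.single j 1))) \<and>
     (\<forall>p. \<exists>q\<in>std_polys. (replacement c d)\<^sup>*\<^sup>* p q)"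

definition PBW_ideal :: "('v::{finite,linorder} \<Rightarrow> 'v \<Rightarrow> 'k::field)
    \<Rightarrow> ('v \<Rightarrow> 'v \<Rightarrow> ('v, 'k) ncpoly) \<Rightarrow> ('v, 'k) ncpoly set \<Rightarrow> ('v, 'k) ncpoly set" where
  "PBW_ideal c d I = Idl\<^bsub>free_alg\<^esub> (I \<union> relations c d)"

text \<open>
  The PBW-reduction-algebra of the datum is \<^term>\<open>free_alg Quot PBW_ideal c d I\<close>.
\<close>

definition PBW_datum :: "('v::{finite,linorder} \<Rightarrow> 'v \<Rightarrow> 'k::field)
    \<Rightarrow> ('v \<Rightarrow> 'v \<Rightarrow> ('v, 'k) ncpoly) \<Rightarrow> ('v, 'k) ncpoly set
    \<Rightarrow> ('v expo \<Rightarrow> 'v expo \<Rightarrow> bool) \<Rightarrow> bool" where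
  "PBW_datum c d I lt \<longleftrightarrow> commutation_system c d lt \<and> well_order_cond lt \<and>
     finite I \<and> I \<subseteq> std_polys \<and> Lexps lt I = lexps lt (PBW_ideal c d I \<inter> std_polys)"

definition ordering_on_module :: "('v::{finite,linorder} \<Rightarrow> 'v \<Rightarrow> 'k::field)
    \<Rightarrow> ('v \<Rightarrow> 'v \<Rightarrow> ('v, 'k) ncpoly) \<Rightarrow> 'e set
    \<Rightarrow> ('v expo \<times> 'e \<Rightarrow> 'v expo \<times> 'e \<Rightarrow> bool) \<Rightarrow> bool" where
  "ordering_on_module c d E lt \<longleftrightarrow> module_monomial_order E lt \<and>
     (\<forall>e\<in>E. commutation_system c d (comp_order lt e))"

section \<open>Free modules over quotients of the free algebra\<close>

text \<open>The fields \<^const>\<open>mult\<close> and \<^const>\<open>one\<close> of a module record have no meaning for a module.\<close>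

definition free_module :: "('a, 'b) ring_scheme \<Rightarrow> 'e set \<Rightarrow> ('a, 'e \<Rightarrow> 'a) module" where
  "free_module R E =
     \<lparr>carrier = E \<rightarrow>\<^sub>E carrier R, mult = undefined, one = undefined,
      zero = (\<lambda>e\<in>E. \<zero>\<^bsub>R\<^esub>), add = (\<lambda>x y. \<lambda>e\<in>E. x e \<oplus>\<^bsub>R\<^esub> y e),
      smult = (\<lambda>a x. \<lambda>e\<in>E. a \<otimes>\<^bsub>R\<^esub> x e)\<rparr>"

definition left_span :: "('a, 'b) ring_scheme \<Rightarrow> 'e set \<Rightarrow> ('e \<Rightarrow> 'a) set \<Rightarrow> ('e \<Rightarrow> 'a) set" where
  "left_span R E X = \<Inter>{N. submodule N R (free_module R E) \<and> X \<subseteq> N}"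

definition two_sided_span ::
    "('a, 'b) ring_scheme \<Rightarrow> 'e set \<Rightarrow> ('e \<Rightarrow> 'a) set \<Rightarrow> ('e \<Rightarrow> 'a) set" where
  "two_sided_span R E X = \<Inter>{N. submodule N R (free_module R E) \<and>
     (\<forall>a\<in>carrier R. \<forall>x\<in>N. (\<lambda>e\<in>E. x e \<otimes>\<^bsub>R\<^esub> a) \<in> N) \<and> X \<subseteq> N}"

definition coset :: "('v, 'k::field) ncpoly set \<Rightarrow> ('v, 'k) ncpoly \<Rightarrow> ('v, 'k) ncpoly set" where
  "coset J p = J +>\<^bsub>free_alg\<^esub> p"

definition coset_vec :: "('v, 'k::field) ncpoly set \<Rightarrow> 'e set \<Rightarrow> ('e \<Rightarrow> ('v, 'k) ncpoly)
    \<Rightarrow> 'e \<Rightarrow> ('v, 'k) ncpoly set" where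
  "coset_vec J E t = (\<lambda>e\<in>E. coset J (t e))"

section \<open>Normal forms and Groebner bases\<close>

text \<open>
  Here \<open>J\<close> is the ideal of relations of the algebra and \<open>Is e\<close> is the finite set of the
  PBW-reduction datum for the component \<open>e\<close>.
\<close>

definition nf :: "('v::{finite,linorder}, 'k::field) ncpoly set
    \<Rightarrow> ('e \<Rightarrow> ('v, 'k) ncpoly set) \<Rightarrow> ('v expo \<times> 'e \<Rightarrow> 'v expo \<times> 'e \<Rightarrow> bool) \<Rightarrow> 'e
    \<Rightarrow> ('v, 'k) ncpoly set \<Rightarrow> ('v, 'k) ncpoly" where
  "nf J Is lt e a = (THE p. p \<in> std_polys \<and> coset J p = a \<and>
     (\<forall>\<alpha>\<in>supp p. \<alpha> \<notin> Lexps (comp_order lt e) (Is e)))"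

definition tau :: "('v::{finite,linorder}, 'k::field) ncpoly set
    \<Rightarrow> ('e \<Rightarrow> ('v, 'k) ncpoly set) \<Rightarrow> ('v expo \<times> 'e \<Rightarrow> 'v expo \<times> 'e \<Rightarrow> bool) \<Rightarrow> 'e set
    \<Rightarrow> ('e \<Rightarrow> ('v, 'k) ncpoly set) \<Rightarrow> 'e \<Rightarrow> ('v, 'k) ncpoly" where
  "tau J Is lt E a = (\<lambda>e\<in>E. nf J Is lt e (a e))"

definition groebner_basis :: "('v::{finite,linorder}, 'k::field) ncpoly set
    \<Rightarrow> ('e \<Rightarrow> ('v, 'k) ncpoly set) \<Rightarrow> ('v expo \<times> 'e \<Rightarrow> 'v expo \<times> 'e \<Rightarrow> bool) \<Rightarrow> 'e set
    \<Rightarrow> ('e \<Rightarrow> ('v, 'k) ncpoly set) set \<Rightarrow> ('e \<Rightarrow> ('v, 'k) ncpoly set) set \<Rightarrow> bool" where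
  "groebner_basis J Is lt E N G \<longleftrightarrow> finite G \<and> G \<subseteq> N \<and>
     (\<forall>m\<in>N. \<exists>a\<in>G \<rightarrow> carrier (free_alg Quot J).
        m = finsum (free_module (free_alg Quot J) E)
              (\<lambda>g. a g \<odot>\<^bsub>free_module (free_alg Quot J) E\<^esub> g) G \<and>
        (\<forall>g\<in>G. let e = lcomp lt E (tau J Is lt E g) in
           lec_le lt (shift (lexp (comp_order lt e) (nf J Is lt e (a g))) (lec lt E (tau J Is lt E g)))
             (lec lt E (tau J Is lt E m))))"

definition induces_groebner_basis :: "('v::{finite,linorder}, 'k::field) ncpoly set
    \<Rightarrow> ('v expo \<times> 'e \<Rightarrow> 'v expo \<times> 'e \<Rightarrow> bool) \<Rightarrow> 'e set
    \<Rightarrow> ('e \<Rightarrow> ('v, 'k) ncpoly set) set \<Rightarrow> ('e \<Rightarrow> ('v, 'k) ncpoly) set \<Rightarrow> bool" where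
  "induces_groebner_basis J lt E M H \<longleftrightarrow>
     finite H \<and> H \<subseteq> (E \<rightarrow>\<^sub>E std_polys) \<and> coset_vec J E ` H \<subseteq> M \<and>
     (\<forall>t\<in>E \<rightarrow>\<^sub>E std_polys. coset_vec J E t \<in> M \<longrightarrow>
        (\<exists>a\<in>H \<rightarrow> std_polys.
           coset_vec J E t = finsum (free_module (free_alg Quot J) E)
             (\<lambda>h. coset J (a h) \<odot>\<^bsub>free_module (free_alg Quot J) E\<^esub> coset_vec J E h) H \<and>
           (\<forall>h\<in>H. lec_le lt (shift (lexp (comp_order lt (lcomp lt E h)) (a h)) (lec lt E h))
              (lec lt E t))))"

section \<open>Homogenization\<close>

definition wdeg :: "('v \<Rightarrow> nat) \<Rightarrow> 'v list \<Rightarrow> nat" where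
  "wdeg w m = sum_list (map w m)"

text \<open>
  With the following convention the degree of \<open>0\<close> is \<open>0\<close>; it plays no role, as the sums below are
  empty for \<open>0\<close> and the condition on \<open>d i j\<close> in \<open>weight_vector\<close> then holds anyway.
\<close>

definition pdeg :: "('v \<Rightarrow> nat) \<Rightarrow> ('v, 'k::field) ncpoly \<Rightarrow> nat" where
  "pdeg w p = Max (insert 0 (wdeg w ` Poly_Mapping.keys p))"

definition mdeg :: "('v \<Rightarrow> nat) \<Rightarrow> 'e set \<Rightarrow> ('e \<Rightarrow> ('v, 'k::field) ncpoly) \<Rightarrow> nat" where
  "mdeg w E t = Max (insert 0 (\<Union>e\<in>E. wdeg w ` Poly_Mapping.keys (t e)))"

definition weight_vector :: "('v::{finite,linorder} \<Rightarrow> nat)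
    \<Rightarrow> ('v \<Rightarrow> 'v \<Rightarrow> ('v, 'k::field) ncpoly) \<Rightarrow> bool" where
  "weight_vector w d \<longleftrightarrow> (\<forall>i j. i < j \<longrightarrow> pdeg w (d i j) \<le> wdeg w [i, j])"

definition homog_to :: "('v \<Rightarrow> nat) \<Rightarrow> nat \<Rightarrow> ('v, 'k::field) ncpoly
    \<Rightarrow> ('v option, 'k) ncpoly" where
  "homog_to w D p =
     (\<Sum>m\<in>Poly_Mapping.keys p. scal (Poly_Mapping.lookup p m) * word (replicate (D - wdeg w m) None @ map Some m))"

definition homog :: "('v \<Rightarrow> nat) \<Rightarrow> ('v, 'k::field) ncpoly \<Rightarrow> ('v option, 'k) ncpoly" where
  "homog w p = homog_to w (pdeg w p) p"

definition homog_vec :: "('v \<Rightarrow> nat) \<Rightarrow> 'e set \<Rightarrow> ('e \<Rightarrow> ('v, 'k::field) ncpoly)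
    \<Rightarrow> 'e \<Rightarrow> ('v option, 'k) ncpoly" where
  "homog_vec w E t = (\<lambda>e\<in>E. homog_to w (mdeg w E t) (t e))"

definition dehom :: "('v option, 'k::field) ncpoly \<Rightarrow> ('v, 'k) ncpoly" where
  "dehom p = (\<Sum>m\<in>Poly_Mapping.keys p. scal (Poly_Mapping.lookup p m) * word (map the (filter (\<lambda>x. x \<noteq> None) m)))"

definition dehom_vec :: "'e set \<Rightarrow> ('e \<Rightarrow> ('v option, 'k::field) ncpoly)
    \<Rightarrow> 'e \<Rightarrow> ('v, 'k) ncpoly" where
  "dehom_vec E t = (\<lambda>e\<in>E. dehom (t e))"

definition hweight :: "('v \<Rightarrow> nat) \<Rightarrow> 'v option \<Rightarrow> nat" where
  "hweight w = case_option 1 w"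

definition hom_ideal :: "('v::{finite,linorder} \<Rightarrow> 'v \<Rightarrow> 'k::field)
    \<Rightarrow> ('v \<Rightarrow> 'v \<Rightarrow> ('v, 'k) ncpoly) \<Rightarrow> ('v, 'k) ncpoly set \<Rightarrow> ('v \<Rightarrow> nat)
    \<Rightarrow> ('v option, 'k) ncpoly set" where
  "hom_ideal c d I w = Idl\<^bsub>free_alg\<^esub>
     (homog w ` PBW_ideal c d I \<union> range (\<lambda>i. word [None, Some i] - word [Some i, None]))"

definition hom_relations :: "('v::{finite,linorder} \<Rightarrow> 'v \<Rightarrow> 'k::field)
    \<Rightarrow> ('v \<Rightarrow> 'v \<Rightarrow> ('v, 'k) ncpoly) \<Rightarrow> ('v \<Rightarrow> nat) \<Rightarrow> ('v option, 'k) ncpoly set" where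
  "hom_relations c d w =
     homog w ` relations c d \<union> range (\<lambda>i. word [Some i, None] - word [None, Some i])"

text \<open>
  An exponent \<open>\<gamma>\<close> of \<open>h\<^sup>\<alpha> x\<^sup>\<beta>\<close> has \<open>\<alpha> = Poly_Mapping.lookup \<gamma> None\<close> and \<open>\<beta> = Poly_Mapping.map_key Some \<gamma>\<close>.
\<close>

definition hom_order :: "('v::{finite,linorder} \<Rightarrow> nat)
    \<Rightarrow> ('v expo \<times> 'e \<Rightarrow> 'v expo \<times> 'e \<Rightarrow> bool)
    \<Rightarrow> 'v option expo \<times> 'e \<Rightarrow> 'v option expo \<times> 'e \<Rightarrow> bool" where
  "hom_order w lt = (\<lambda>(\<gamma>, e) (\<gamma>', e').
     let deg = (\<lambda>\<delta>. Poly_Mapping.lookup \<delta> None + (\<Sum>i\<in>UNIV. w i * Poly_Mapping.lookup \<delta> (Some i))) in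
     deg \<gamma> < deg \<gamma>' \<or> (deg \<gamma> = deg \<gamma>' \<and>
       lt (Poly_Mapping.map_key Some \<gamma>, e) (Poly_Mapping.map_key Some \<gamma>', e')))"

definition homogeneous :: "('v \<Rightarrow> nat) \<Rightarrow> nat \<Rightarrow> ('v, 'k::field) ncpoly \<Rightarrow> bool" where
  "homogeneous w k p \<longleftrightarrow> (\<forall>m\<in>Poly_Mapping.keys p. wdeg w m = k)"

definition homogeneous_vec :: "('v \<Rightarrow> nat) \<Rightarrow> ('v, 'k::field) ncpoly set \<Rightarrow> 'e set
    \<Rightarrow> ('e \<Rightarrow> ('v, 'k) ncpoly set) \<Rightarrow> bool" where
  "homogeneous_vec w J E a \<longleftrightarrow>
     (\<exists>k. \<exists>t\<in>E \<rightarrow>\<^sub>E UNIV. a = coset_vec J E t \<and> (\<forall>e\<in>E. homogeneous w k (t e)))"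

text \<open>
  The sets \<open>hom_basis c d I w lt e\<close> are a choice of finite sets of homogeneous elements forming
  PBW-reduction data of the homogenized algebra, which exist for positive weights. The normal forms
  do not depend on the choice: by the definition of a PBW-reduction datum, any two choices have the
  same \<^const>\<open>Lexps\<close>.
\<close>

definition hom_basis :: "('v::{finite,linorder} \<Rightarrow> 'v \<Rightarrow> 'k::field)
    \<Rightarrow> ('v \<Rightarrow> 'v \<Rightarrow> ('v, 'k) ncpoly) \<Rightarrow> ('v, 'k) ncpoly set \<Rightarrow> ('v \<Rightarrow> nat)
    \<Rightarrow> ('v expo \<times> 'e \<Rightarrow> 'v expo \<times> 'e \<Rightarrow> bool) \<Rightarrow> 'e \<Rightarrow> ('v option, 'k) ncpoly set" where
  "hom_basis c d I w lt e = (SOME B.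
     (\<forall>p\<in>B. \<exists>k. homogeneous (hweight w) k p) \<and>
     (\<exists>c' d'. relations c' d' = hom_relations c d w \<and>
        PBW_datum c' d' B (comp_order (hom_order w lt) e) \<and>
        PBW_ideal c' d' B = hom_ideal c d I w))"

end

theory Submission
  imports Defs "HOL-Library.Multiset" "HOL-Library.Infinite_Set"
begin

text \<open>
  Let \<open>J\<close> be the ideal of relations of the algebra, \<open>J\<^sub>w\<close> that of its homogenization, and \<open>t\<close> a vector
  of standard polynomials whose class lies in \<open>M\<close>. The idea is to homogenize \<open>t\<close>, to divide in the
  homogenized module, where the ordering is a well-ordering, and to set \<open>h = 1\<close> in the result.

  The two ideals determine each other: an element lies in \<open>J\<^sub>w\<close> iff all its homogeneous components
  fall into \<open>J\<close> when \<open>h\<close> is set to \<open>1\<close> (\<open>hom_ideal_iff\<close>). Hence dehomogenization maps the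
  homogenized module into \<open>M\<close> (\<open>dehom_rep_span\<close>), and conversely the homogenization of \<open>t\<close> to any
  sufficiently large degree \<open>D\<close> lies in the homogenized module (\<open>homog_rep_span\<close>): a combination of
  generators equal to \<open>t\<close> can be homogenized term by term after multiplication by a power of \<open>h\<close>. The
  left and the two-sided case are treated together, since nothing else about the submodule is used.

  Now take the representation of this homogenization by the homogeneous set \<open>G\<close> and keep only the
  homogeneous components of the coefficients that contribute to degree \<open>D\<close>. As \<open>J\<^sub>w\<close> is a homogeneous
  ideal, this is still a representation, and it dehomogenizes to one of \<open>t\<close>. The condition on leading
  exponents says that every monomial of \<open>a\<^sub>g\<close> times every monomial of \<open>g\<close> is dominated by some
  monomial of the normal form (\<open>lec_le_shift_iff\<close>), which in turn is dominated by a monomial of the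
  homogenization of \<open>t\<close> (\<open>nf_dominated\<close>). All monomials involved have degree \<open>D\<close>, and there the
  homogenized ordering is the given ordering of the dehomogenized monomials. So the condition
  survives dehomogenization (\<open>dehom_induces_groebner_basis\<close>).

  This relies on normal forms in the homogenized algebra, hence on the existence of finite sets of
  homogeneous elements that form PBW-reduction data for it (\<open>hom_basis_exists\<close>). With positive
  weights only finitely many monomials lie below a given one, so the homogenized ordering is
  well-founded (\<open>wf_hom_order\<close>). Rewriting with the homogenized relations terminates, since a
  replacement sorts an inversion or lowers the exponent (\<open>replacement_terminates\<close>), and each word is
  a nonzero multiple of the standard word of the same exponent up to smaller terms
  (\<open>word_standard_form\<close>). Therefore the leading exponents of \<open>J\<^sub>w\<close> are closed under addition of
  exponents (\<open>lexps_add\<close>), and Dickson's lemma selects finitely many elements of \<open>J\<^sub>w\<close>, which can be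
  taken homogeneous. Division by them leads to unique normal forms, homogeneous for homogeneous
  elements (\<open>homogeneous_nf\<close>).
\<close>

abbreviation "lookup \<equiv> Poly_Mapping.lookup"
abbreviation "keys \<equiv> Poly_Mapping.keys"
abbreviation "single \<equiv> Poly_Mapping.single"

section \<open>Linear maps on the free algebra\<close>

lemma word_append: "word (u @ v) = word u * word v"
  by (simp add: word_def mult_single plus_list_def)

lemma word_Nil [simp]: "word [] = 1"
  by (metis single_one word_def zero_list_def)

lemma scal_0 [simp]: "scal 0 = 0" and scal_1 [simp]: "scal 1 = 1"
  and scal_add: "scal (a + b) = scal a + scal b"
  and scal_uminus: "scal (- a) = - scal a"
  and scal_mult: "scal (a * b) = scal a * scal b"
  using word_Nil by (simp_all add: scal_def word_def single_add single_uminus mult_single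
      plus_list_def)

lemma lookup_scal_mult [simp]: "lookup (scal k * p) m = k * lookup p m"
  unfolding scal_def zero_list_def [symmetric] mult_map_scale_conv_mult [symmetric]
  by (simp add: Poly_Mapping.map.rep_eq when_def)

lemma lookup_word: "lookup (word u) m = (if u = m then 1 else 0)"
  by (simp add: word_def lookup_single when_def)

lemma keys_word [simp]: "keys (word u :: ('a, 'k::field) ncpoly) = {u}"
  by (simp add: word_def)

lemma keys_scal_mult: "keys (scal k * p) \<subseteq> keys p"
  by (auto simp: in_keys_iff)

lemma keys_diff_subset: "keys (p - q) \<subseteq> keys p \<union> keys q"
  for p q :: "('a, 'k::field) ncpoly"
  by (auto simp: in_keys_iff lookup_minus)

text \<open>
  Homogenization, dehomogenization, homogeneous components and reduction to standard form are all
  linear extensions of maps on words. Linearity, multiplicativity and the bound on the support are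
  therefore proved once, here.
\<close>

definition lin :: "('a list \<Rightarrow> ('b, 'k::field) ncpoly) \<Rightarrow> ('a, 'k) ncpoly \<Rightarrow> ('b, 'k) ncpoly" where
  "lin f p = (\<Sum>m\<in>keys p. scal (lookup p m) * f m)"

lemma lin_superset:
  assumes "finite X" "keys p \<subseteq> X"
  shows "lin f p = (\<Sum>m\<in>X. scal (lookup p m) * f m)"
  unfolding lin_def using assms
  by (intro sum.mono_neutral_left) (auto simp: in_keys_iff)

lemma lin_0 [simp]: "lin f 0 = 0"
  by (simp add: lin_def)

lemma lin_add: "lin f (p + q) = lin f p + lin f q"
proof -
  have "finite (keys p \<union> keys q)" by simp
  then show ?thesis
    using Poly_Mapping.keys_add[of p q]
    by (simp add: lin_superset[of "keys p \<union> keys q"] lookup_add scal_add distrib_right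
        sum.distrib)
qed

lemma lin_scal: "lin f (scal k * p) = scal k * lin f p"
  using keys_scal_mult[of k p]
  by (simp add: lin_superset[of "keys p"] scal_mult sum_distrib_left mult.assoc)

lemma scal_neg1: "scal (- 1) * p = - p"
  by (simp add: scal_uminus)

lemma lin_uminus: "lin f (- p) = - lin f p"
  using lin_scal[of f "-1" p] by (simp add: scal_neg1)

lemma lin_diff: "lin f (p - q) = lin f p - lin f q"
  using lin_add[of f p "- q"] by (simp add: lin_uminus)

lemma lin_sum: "lin f (\<Sum>x\<in>X. p x) = (\<Sum>x\<in>X. lin f (p x))"
  by (induction X rule: infinite_finite_induct) (simp_all add: lin_add)

lemma lin_word [simp]: "lin f (word m) = f m"
  by (simp add: lin_def lookup_word)

lemma lin_word_id: "lin word p = p"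
proof (rule poly_mapping_eqI)
  fix m
  have "lookup (lin word p) m = (\<Sum>u\<in>keys p. if u = m then lookup p u else 0)"
    by (simp add: lin_def lookup_sum lookup_word if_distrib cong: if_cong)
  also have "\<dots> = lookup p m"
    by (auto simp: in_keys_iff)
  finally show "lookup (lin word p) m = lookup p m" .
qed

lemma ncpoly_induct [case_names zero add mono]:
  assumes "P 0" "\<And>p q. P p \<Longrightarrow> P q \<Longrightarrow> P (p + q)" "\<And>k m. P (scal k * word m)"
  shows "P p"
proof -
  have "P (\<Sum>m\<in>X. scal (lookup p m) * word m)" if "finite X" for X
    using that by (induction X rule: finite_induct) (simp_all add: assms)
  from this[of "keys p"] show ?thesis
    by (simp add: lin_word_id[unfolded lin_def])
qed

lemma keys_lin: "keys (lin f p) \<subseteq> (\<Union>m\<in>keys p. keys (f m))"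
  unfolding lin_def using keys_scal_mult by (fastforce dest!: subsetD[OF keys_sum])

lemma scal_commute: "scal k * p = p * scal k"
proof (induction p rule: ncpoly_induct)
  case (mono l m)
  then show ?case
    by (simp add: scal_def word_def mult_single plus_list_def mult.commute)
qed (simp_all add: distrib_left distrib_right)

lemma scal_left_commute: "p * (scal k * q) = scal k * (p * q)"
  by (metis mult.assoc scal_commute)

lemma word_scal_commute: "word u * (scal k * q) = scal k * (word u * q)"
  by (rule scal_left_commute)

lemma lin_mult:
  assumes "\<And>u v. f (u @ v) = f u * f v"
  shows "lin f (p * q) = lin f p * lin f q"
proof (induction p rule: ncpoly_induct)
  case (mono k u)
  show ?case
  proof (induction q rule: ncpoly_induct)
    case (mono l v)
    have "lin f (scal k * word u * (scal l * word v)) = lin f (scal k * (scal l * word (u @ v)))"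
      by (simp add: word_append mult.assoc word_scal_commute)
    also have "\<dots> = lin f (scal k * word u) * lin f (scal l * word v)"
      by (simp add: lin_scal assms mult.assoc scal_left_commute[of "f u"])
    finally show ?case .
  qed (simp_all add: distrib_left lin_add)
qed (simp_all add: distrib_right lin_add)

section \<open>Ideals of the free algebra\<close>

lemma free_alg_simps [simp]:
  "carrier free_alg = UNIV" "monoid.mult free_alg = (*)" "one free_alg = 1" "zero free_alg = 0"
  "add free_alg = (+)"
  by (simp_all add: free_alg_def)

lemma ring_free_alg: "ring (free_alg :: ('a, 'k::field) ncpoly ring)"
proof (rule ringI)
  show "abelian_group (free_alg :: ('a, 'k::field) ncpoly ring)"
  proof (rule abelian_groupI)
    show "\<exists>y\<in>carrier free_alg. y \<oplus>\<^bsub>free_alg\<^esub> x = \<zero>\<^bsub>free_alg\<^esub>"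
      for x :: "('a, 'k) ncpoly"
      by (rule bexI[of _ "- x"]) simp_all
  qed (simp_all add: add_ac)
  show "monoid (free_alg :: ('a, 'k::field) ncpoly ring)"
    by (rule monoidI) (auto simp: mult.assoc)
qed (simp_all add: distrib_left distrib_right)

lemma a_inv_free_alg [simp]: "a_inv free_alg x = - x"
proof -
  interpret ring "free_alg :: ('a, 'k::field) ncpoly ring" by (rule ring_free_alg)
  show ?thesis by (rule minus_equality) simp_all
qed

lemma ideal_closed:
  assumes "ideal J free_alg"
  shows ideal_0: "0 \<in> J" and ideal_add: "p \<in> J \<Longrightarrow> q \<in> J \<Longrightarrow> p + q \<in> J"
    and ideal_mult_left: "p \<in> J \<Longrightarrow> q * p \<in> J" and ideal_mult_right: "p \<in> J \<Longrightarrow> p * q \<in> J"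
    and ideal_uminus: "p \<in> J \<Longrightarrow> - p \<in> J" and ideal_diff: "p \<in> J \<Longrightarrow> q \<in> J \<Longrightarrow> p - q \<in> J"
proof -
  interpret ideal J free_alg by fact
  show "0 \<in> J" using additive_subgroup.zero_closed[OF is_additive_subgroup] by simp
  show add: "p \<in> J \<Longrightarrow> q \<in> J \<Longrightarrow> p + q \<in> J" for p q 
    using additive_subgroup.a_closed[OF is_additive_subgroup] by simp
  show left: "p \<in> J \<Longrightarrow> q * p \<in> J" for p q using I_l_closed by simp
  show "p \<in> J \<Longrightarrow> p * q \<in> J" using I_r_closed by simp
  show neg: "p \<in> J \<Longrightarrow> - p \<in> J" for p using left[of p "- 1"] by simp
  show "p \<in> J \<Longrightarrow> q \<in> J \<Longrightarrow> p - q \<in> J" using add[of p "- q"] neg[of q] by simp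
qed

lemma ideal_sum:
  assumes "ideal J free_alg" "\<And>x. x \<in> X \<Longrightarrow> p x \<in> J"
  shows "(\<Sum>x\<in>X. p x) \<in> J"
  using assms(2)
  by (induction X rule: infinite_finite_induct) (simp_all add: ideal_closed[OF assms(1)])

text \<open>
  By linearity, closure under multiplication by words is enough; for words the effect of taking
  homogeneous components can be computed.
\<close>

lemma free_alg_idealI:
  fixes J :: "('a, 'k::field) ncpoly set"
  assumes "0 \<in> J" "\<And>p q. p \<in> J \<Longrightarrow> q \<in> J \<Longrightarrow> p + q \<in> J"
    and scal: "\<And>k p. p \<in> J \<Longrightarrow> scal k * p \<in> J"
    and left: "\<And>u p. p \<in> J \<Longrightarrow> word u * p \<in> J"
    and right: "\<And>u p. p \<in> J \<Longrightarrow> p * word u \<in> J"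
  shows "ideal J free_alg"
proof (rule idealI[OF ring_free_alg])
  show "subgroup J (add_monoid free_alg)"
  proof (rule group.subgroupI)
    show "Group.group (add_monoid free_alg)"
      using abelian_group.a_group[OF ring.is_abelian_group[OF ring_free_alg]] .
    show "inv\<^bsub>add_monoid free_alg\<^esub> p \<in> J" if "p \<in> J" for p
      using scal[OF that, of "- 1"] a_inv_free_alg[of p, unfolded a_inv_def]
      by (simp add: scal_neg1)
  qed (use assms in auto)
  show "q \<otimes>\<^bsub>free_alg\<^esub> p \<in> J" if p: "p \<in> J" for p q
    using p by (induction q rule: ncpoly_induct) (simp_all add: distrib_right mult.assoc assms)
  show "p \<otimes>\<^bsub>free_alg\<^esub> q \<in> J" if p: "p \<in> J" for p q
    using p by (induction q rule: ncpoly_induct)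
      (simp_all add: distrib_left assms scal_left_commute)
qed

lemma ideal_Idl: "ideal (Idl\<^bsub>free_alg\<^esub> S) free_alg"
  by (rule ring.genideal_ideal[OF ring_free_alg]) simp

lemma Idl_superset: "S \<subseteq> Idl\<^bsub>free_alg\<^esub> S"
  by (rule ring.genideal_self[OF ring_free_alg]) simp

lemma Idl_minimal: "ideal J free_alg \<Longrightarrow> S \<subseteq> J \<Longrightarrow> Idl\<^bsub>free_alg\<^esub> S \<subseteq> J"
  by (rule ring.genideal_minimal[OF ring_free_alg])

section \<open>Exponents of words\<close>

definition expo :: "'v list \<Rightarrow> 'v expo" where
  "expo u = sum_list (map (\<lambda>i. single i 1) u)"

lemma expo_simps [simp]: "expo [] = 0" "expo (i # u) = single i 1 + expo u"
  "expo (u @ v) = expo u + expo v"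
  by (simp_all add: expo_def)

lemma lookup_expo: "lookup (expo u) i = count_list u i"
  by (induction u) (simp_all add: lookup_add lookup_single when_def)

lemma sorted_concat_replicate:
  "sorted xs \<Longrightarrow> sorted (concat (map (\<lambda>i. replicate (f i) i) xs))"
  by (induction xs) (auto simp: sorted_append)

lemma count_concat_replicate:
  "distinct xs \<Longrightarrow>
    count_list (concat (map (\<lambda>i. replicate (f i) i) xs)) i = (if i \<in> set xs then f i else 0)"
proof -
  have [simp]: "count_list (replicate n j) i = (if i = j then n else 0)" for n j
    by (induction n) auto
  show "distinct xs \<Longrightarrow> ?thesis" by (induction xs) auto
qed

lemma sorted_std_word: "sorted (std_word \<alpha>)"
  by (simp add: std_word_def sorted_concat_replicate)

lemma expo_std_word [simp]: "expo (std_word \<alpha>) = \<alpha>"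
  by (rule poly_mapping_eqI) (simp add: lookup_expo std_word_def count_concat_replicate)

lemma expo_eq_iff_mset: "expo u = expo v \<longleftrightarrow> mset u = mset v"
  by (simp add: poly_mapping_eq_iff fun_eq_iff lookup_expo multiset_eq_iff count_mset)

text \<open>
  A standard word is the sorted arrangement of its letters. The standard polynomials are thus those
  whose words are sorted.
\<close>

lemma std_word_expo: "sorted u \<Longrightarrow> std_word (expo u) = u"
  by (metis expo_eq_iff_mset expo_std_word properties_for_sort sorted_sort_id sorted_std_word)

lemma range_std_word: "range std_word = {u. sorted u}"
proof (intro equalityI subsetI)
  show "u \<in> range std_word" if "u \<in> {u. sorted u}" for u
    using that std_word_expo[of u] by (metis mem_Collect_eq rangeI)
qed (auto simp: sorted_std_word)

lemma inj_std_word: "inj std_word"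
  by (metis expo_std_word injI)

lemma std_polys_iff: "p \<in> std_polys \<longleftrightarrow> (\<forall>u\<in>keys p. sorted u)"
  by (auto simp: std_polys_def range_std_word)

lemma mem_supp: "\<alpha> \<in> supp p \<longleftrightarrow> std_word \<alpha> \<in> keys p"
  by (simp add: supp_def in_keys_iff)

lemma finite_supp [simp]: "finite (supp p)"
proof -
  have "supp p = std_word -` keys p" by (auto simp: mem_supp)
  then show ?thesis by (simp add: finite_vimageI inj_std_word)
qed

lemma expo_mem_supp: "p \<in> std_polys \<Longrightarrow> u \<in> keys p \<Longrightarrow> expo u \<in> supp p"
  by (simp add: mem_supp std_polys_iff std_word_expo)

lemma supp_empty: "p \<in> std_polys \<Longrightarrow> supp p = {} \<Longrightarrow> p = 0"
  using expo_mem_supp keys_eq_empty by blast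

lemma std_0 [simp]: "0 \<in> std_polys"
  and std_add: "p \<in> std_polys \<Longrightarrow> q \<in> std_polys \<Longrightarrow> p + q \<in> std_polys"
  and std_diff: "p \<in> std_polys \<Longrightarrow> q \<in> std_polys \<Longrightarrow> p - q \<in> std_polys"
  and std_scal: "p \<in> std_polys \<Longrightarrow> scal k * p \<in> std_polys"
  and std_lin: "(\<And>m. m \<in> keys r \<Longrightarrow> f m \<in> std_polys) \<Longrightarrow> lin f r \<in> std_polys"
  and std_sorted_word: "sorted u \<Longrightarrow> word u \<in> std_polys"
  for p :: "('v::{finite,linorder}, 'k::field) ncpoly"
  using Poly_Mapping.keys_add[of p q] keys_diff_subset[of p q] keys_scal_mult[of k p]
    keys_lin[of f r]
  by (auto simp: std_polys_iff)

lemma std_sum: "(\<And>x. x \<in> X \<Longrightarrow> p x \<in> std_polys) \<Longrightarrow> (\<Sum>x\<in>X. p x) \<in> std_polys"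
  by (induction X rule: infinite_finite_induct) (simp_all add: std_add)

lemma supp_0 [simp]: "supp 0 = {}"
  and supp_add: "supp (p + q) \<subseteq> supp p \<union> supp q"
  and supp_diff: "supp (p - q) \<subseteq> supp p \<union> supp q"
  and supp_scal: "supp (scal k * p) \<subseteq> supp p"
  by (auto simp: supp_def lookup_add lookup_minus)

section \<open>Leading data\<close>

lemma largest_eq_Some:
  assumes "finite X" "transp_on X lt" "irreflp_on X lt" "totalp_on X lt"
  shows "largest lt X = Some x \<longleftrightarrow> x \<in> X \<and> (\<forall>y\<in>X. y = x \<or> lt y x)"
proof (cases "X = {}")
  case False
  let ?P = "\<lambda>x. x \<in> X \<and> (\<forall>y\<in>X. y = x \<or> lt y x)"
  obtain g where g: "?P g"
    using Finite_Set.bex_greatest_element[OF assms(1) False assms(2,4)] by auto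
  have unique: "x = y" if "?P x" "?P y" for x y
  proof (rule ccontr)
    assume "x \<noteq> y"
    then have "lt x y" "lt y x" using that by auto
    then show False
      using that transp_onD[OF assms(2), of x y x] irreflp_onD[OF assms(3), of x] by simp
  qed
  have "(THE x. ?P x) = g" by (rule the_equality[of ?P, OF g unique[OF _ g]])
  then have "largest lt X = Some g" using False by (simp add: largest_def)
  then show ?thesis using g unique[OF g, of x] by auto
qed (simp add: largest_def)

lemma largest_eq_None [simp]: "largest lt X = None \<longleftrightarrow> X = {}"
  by (simp add: largest_def)

lemma monomial_orderD:
  assumes "monomial_order lt"
  shows "transp lt" "irreflp lt" "totalp lt" "lt \<alpha> \<beta> \<Longrightarrow> lt (\<alpha> + \<gamma>) (\<beta> + \<gamma>)"
  using assms by (auto simp: monomial_order_def)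

lemma lexp_eq_Some:
  "monomial_order lt \<Longrightarrow>
    lexp lt p = Some \<alpha> \<longleftrightarrow> \<alpha> \<in> supp p \<and> (\<forall>\<beta>\<in>supp p. \<beta> = \<alpha> \<or> lt \<beta> \<alpha>)"
  unfolding lexp_def
  using monomial_orderD(1-3)[of lt]
  by (intro largest_eq_Some)
    (auto intro: transp_on_subset irreflp_on_subset totalp_on_subset)

lemma lexp_eq_None: "lexp lt p = None \<longleftrightarrow> supp p = {}"
  by (simp add: lexp_def)

lemma monomial_order_comp:
  "module_monomial_order E lt \<Longrightarrow> e \<in> E \<Longrightarrow> monomial_order (comp_order lt e)"
  unfolding module_monomial_order_def monomial_order_def comp_order_def
  by (intro conjI irreflpI transpI totalpI allI impI)
    (blast dest: irreflp_onD transp_onD totalp_onD)+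

lemma mem_msupp: "(\<alpha>, e) \<in> msupp E t \<longleftrightarrow> e \<in> E \<and> \<alpha> \<in> supp (t e)"
  by (simp add: msupp_def)

lemma finite_msupp: "finite E \<Longrightarrow> finite (msupp E t)"
proof -
  have "msupp E t = (\<Union>e\<in>E. (\<lambda>\<alpha>. (\<alpha>, e)) ` supp (t e))"
    by (auto simp: mem_msupp)
  then show "finite E \<Longrightarrow> ?thesis" by simp
qed

lemma lec_eq_Some:
  assumes "module_monomial_order E lt" "finite E"
  shows "lec lt E t = Some x \<longleftrightarrow> x \<in> msupp E t \<and> (\<forall>y\<in>msupp E t. y = x \<or> lt y x)"
proof -
  have "msupp E t \<subseteq> UNIV \<times> E" by (auto simp: msupp_def)
  then show ?thesis
    unfolding lec_def using assms
    by (intro largest_eq_Some finite_msupp) (auto simp: module_monomial_order_def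
        intro: transp_on_subset irreflp_on_subset totalp_on_subset)
qed

lemma lec_eq_None: "lec lt E t = None \<longleftrightarrow> msupp E t = {}"
  by (simp add: lec_def)

text \<open>
  Comparing leading exponents amounts to comparing all exponents: every product of a monomial of
  the coefficient with a monomial of the vector is dominated by some monomial of \<open>t\<close>. In this form
  the condition is inherited by parts of the coefficient, by sums of coefficients, and by
  dehomogenizations.
\<close>

lemma lec_le_shift_iff:
  assumes mmo: "module_monomial_order E lt" and fin: "finite E"
  shows "lec_le lt (shift (lexp (comp_order lt (lcomp lt E h)) a) (lec lt E h)) (lec lt E t) \<longleftrightarrow>
    (\<forall>\<gamma>\<in>supp a. \<forall>(\<delta>, e)\<in>msupp E h. \<exists>y\<in>msupp E t. (\<gamma> + \<delta>, e) = y \<or> lt (\<gamma> + \<delta>, e) y)"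
    (is "?L \<longleftrightarrow> ?R")
proof (cases "lec lt E h")
  case None
  then have "msupp E h = {}" by (simp add: lec_eq_None)
  with None show ?thesis by (cases "lexp (comp_order lt (lcomp lt E h)) a") simp_all
next
  case (Some x)
  obtain \<delta> e where x: "x = (\<delta>, e)" by (cases x)
  have h: "(\<delta>, e) \<in> msupp E h" "\<And>y. y \<in> msupp E h \<Longrightarrow> y = (\<delta>, e) \<or> lt y (\<delta>, e)"
    using Some x by (auto simp: lec_eq_Some[OF assms])
  then have e: "e \<in> E" by (simp add: mem_msupp)
  have [simp]: "lcomp lt E h = e" by (simp add: lcomp_def Some x)
  note mo = monomial_order_comp[OF mmo e]
  have trans: "lt x z" if "lt x y" "lt y z" "snd x \<in> E" "snd y \<in> E" "snd z \<in> E" for x y z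
  proof -
    have "x \<in> UNIV \<times> E" "y \<in> UNIV \<times> E" "z \<in> UNIV \<times> E"
      using that by (cases x; cases y; cases z; simp)+
    then show ?thesis
      using mmo that transp_onD[of "UNIV \<times> E" lt x y z] by (simp add: module_monomial_order_def)
  qed
  have add: "lt (\<gamma> + \<alpha>, e) (\<gamma> + \<alpha>', e')" if "lt (\<alpha>, e) (\<alpha>', e')" "e \<in> E" "e' \<in> E"
    for \<alpha> \<alpha>' \<gamma> e e'
    using mmo that unfolding module_monomial_order_def by (simp add: add.commute[of \<gamma>])
  show ?thesis
  proof (cases "lexp (comp_order lt e) a")
    case None
    then show ?thesis by (simp add: lexp_eq_None[THEN iffD1, OF None])
  next
    case a: (Some \<gamma>)
    have a: "\<gamma> \<in> supp a" "\<And>\<beta>. \<beta> \<in> supp a \<Longrightarrow> \<beta> = \<gamma> \<or> lt (\<beta>, e) (\<gamma>, e)"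
      and [simp]: "lexp (comp_order lt e) a = Some \<gamma>"
      using a lexp_eq_Some[OF mo, of a \<gamma>] by (auto simp add: comp_order_def)
    show ?thesis
    proof
      assume ?L
      then obtain y where y: "lec lt E t = Some y" "(\<delta> + \<gamma>, e) = y \<or> lt (\<delta> + \<gamma>, e) y"
        by (cases "lec lt E t") (auto simp: Some x)
      then have yt: "y \<in> msupp E t" by (simp add: lec_eq_Some[OF assms])
      then have yE: "snd y \<in> E" by (cases y) (simp add: mem_msupp)
      show ?R
      proof (clarify, rule bexI[OF _ yt])
        fix \<beta> \<epsilon> e' assume "\<beta> \<in> supp a" "(\<epsilon>, e') \<in> msupp E h"
        then have e': "e' \<in> E" and 1: "\<beta> = \<gamma> \<or> lt (\<beta>, e) (\<gamma>, e)"
          and 2: "(\<epsilon>, e') = (\<delta>, e) \<or> lt (\<epsilon>, e') (\<delta>, e)"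
          using a(2)[of \<beta>] h(2)[of "(\<epsilon>, e')"] by (auto simp: mem_msupp)
        have 1: "\<beta> + \<delta> = \<gamma> + \<delta> \<or> lt (\<beta> + \<delta>, e) (\<gamma> + \<delta>, e)"
          using 1 add[of \<beta> e \<gamma> e \<delta>] e by (auto simp: add.commute[of \<delta>])
        have 2: "(\<beta> + \<epsilon>, e') = (\<beta> + \<delta>, e) \<or> lt (\<beta> + \<epsilon>, e') (\<beta> + \<delta>, e)"
          using 2 add e e' by blast
        have 3: "(\<beta> + \<epsilon>, e') = (\<gamma> + \<delta>, e) \<or> lt (\<beta> + \<epsilon>, e') (\<gamma> + \<delta>, e)"
          using 1 2 trans[of "(\<beta> + \<epsilon>, e')" "(\<beta> + \<delta>, e)" "(\<gamma> + \<delta>, e)"] e e' by auto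
        show "(\<beta> + \<epsilon>, e') = y \<or> lt (\<beta> + \<epsilon>, e') y"
          using 3 y(2) trans[of "(\<beta> + \<epsilon>, e')" "(\<gamma> + \<delta>, e)" y] e e' yE
          by (auto simp: add.commute[of \<delta>])
      qed
    next
      assume ?R
      then obtain y where y: "y \<in> msupp E t" "(\<gamma> + \<delta>, e) = y \<or> lt (\<gamma> + \<delta>, e) y"
        using a h by blast
      then obtain z where z: "lec lt E t = Some z" by (cases "lec lt E t") (auto simp: lec_eq_None)
      then have "z \<in> msupp E t" "y = z \<or> lt y z" using y by (auto simp: lec_eq_Some[OF assms])
      moreover have "snd y \<in> E" "snd z \<in> E"
        using y(1) calculation by (cases y; cases z; simp add: mem_msupp)+
      ultimately have "(\<gamma> + \<delta>, e) = z \<or> lt (\<gamma> + \<delta>, e) z"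
        using y(2) trans[of "(\<gamma> + \<delta>, e)" y z] e by auto
      then show ?L by (simp add: Some x z add.commute[of \<gamma>])
    qed
  qed
qed

section \<open>Free modules over quotients\<close>

lemma coset_conv: "coset J p = {j + p | j. j \<in> J}"
  by (auto simp: coset_def a_r_coset_def')

lemma carrier_Quot: "carrier (free_alg Quot J) = range (coset J)"
  by (auto simp: FactRing_def A_RCOSETS_def' coset_def)

lemma coset_mem_carrier [simp]: "coset J p \<in> carrier (free_alg Quot J)"
  by (simp add: carrier_Quot)

lemma coset_eq_iff:
  assumes "ideal J free_alg"
  shows "coset J p = coset J q \<longleftrightarrow> p - q \<in> J"
proof
  assume "coset J p = coset J q"
  moreover have "p \<in> coset J p" using ideal_0[OF assms] by (force simp: coset_conv)
  ultimately show "p - q \<in> J" by (auto simp: coset_conv)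
next
  have *: "coset J p \<subseteq> coset J q" if "p - q \<in> J" for p q
  proof
    fix x assume "x \<in> coset J p"
    then obtain j where "j \<in> J" "x = j + p" by (auto simp: coset_conv)
    then have "j + (p - q) \<in> J" "x = (j + (p - q)) + q"
      using ideal_add[OF assms _ that] by simp_all
    then show "x \<in> coset J q" unfolding coset_conv by blast
  qed
  assume "p - q \<in> J"
  moreover from this have "q - p \<in> J" using ideal_uminus[OF assms, of "p - q"] by simp
  ultimately show "coset J p = coset J q" using * by blast
qed

lemma Quot_simps:
  assumes "ideal J free_alg"
  shows "coset J p \<otimes>\<^bsub>free_alg Quot J\<^esub> coset J q = coset J (p * q)"
    and "coset J p \<oplus>\<^bsub>free_alg Quot J\<^esub> coset J q = coset J (p + q)"
    and "\<zero>\<^bsub>free_alg Quot J\<^esub> = coset J 0"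
proof -
  interpret ideal J free_alg by fact
  show "coset J p \<otimes>\<^bsub>free_alg Quot J\<^esub> coset J q = coset J (p * q)"
    using rcoset_mult_add[of p q] by (simp add: FactRing_def coset_def)
  show "coset J p \<oplus>\<^bsub>free_alg Quot J\<^esub> coset J q = coset J (p + q)"
    using a_rcos_sum[of p q] by (simp add: FactRing_def coset_def)
  show "\<zero>\<^bsub>free_alg Quot J\<^esub> = coset J 0"
    by (simp add: FactRing_def coset_conv)
qed

abbreviation quot_module :: "('v, 'k::field) ncpoly set \<Rightarrow> 'e set \<Rightarrow>
    (('v, 'k) ncpoly set, 'e \<Rightarrow> ('v, 'k) ncpoly set) module" where
  "quot_module J E \<equiv> free_module (free_alg Quot J) E"

lemma coset_vec_eq_iff:
  "ideal J free_alg \<Longrightarrow>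
    coset_vec J E s = coset_vec J E t \<longleftrightarrow> (\<forall>e\<in>E. s e - t e \<in> J)"
  by (auto simp: coset_vec_def fun_eq_iff coset_eq_iff)

lemma carrier_quot_module: "carrier (quot_module J E) = range (coset_vec J E)"
proof (intro equalityI subsetI)
  fix x assume x: "x \<in> carrier (quot_module J E)"
  then have "\<forall>e\<in>E. \<exists>p. x e = coset J p"
    by (auto simp: free_module_def carrier_Quot dest!: PiE_mem)
  then obtain t where t: "\<forall>e\<in>E. x e = coset J (t e)" by metis
  have "x = coset_vec J E t"
  proof (rule ext)
    have "x \<in> E \<rightarrow>\<^sub>E carrier (free_alg Quot J)" using x by (simp add: free_module_def)
    then show "x e = coset_vec J E t e" for e
      using t by (cases "e \<in> E") (auto simp: coset_vec_def dest: PiE_arb)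
  qed
  then show "x \<in> range (coset_vec J E)" by simp
qed (auto simp: free_module_def coset_vec_def)

lemma coset_vec_mem_carrier [simp]: "coset_vec J E t \<in> carrier (quot_module J E)"
  by (simp add: carrier_quot_module)

lemma quot_module_simps:
  assumes "ideal J free_alg"
  shows "coset_vec J E s \<oplus>\<^bsub>quot_module J E\<^esub> coset_vec J E t = coset_vec J E (\<lambda>e. s e + t e)"
    and "\<zero>\<^bsub>quot_module J E\<^esub> = coset_vec J E (\<lambda>_. 0)"
    and "coset J p \<odot>\<^bsub>quot_module J E\<^esub> coset_vec J E t = coset_vec J E (\<lambda>e. p * t e)"
    and "(\<lambda>e\<in>E. coset_vec J E t e \<otimes>\<^bsub>free_alg Quot J\<^esub> coset J p) = coset_vec J E (\<lambda>e. t e * p)"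
  by (auto simp: free_module_def coset_vec_def Quot_simps[OF assms] fun_eq_iff)

lemma abelian_group_quot_module:
  assumes "ideal J free_alg"
  shows "abelian_group (quot_module J E)"
proof (rule abelian_groupI)
  note simps = quot_module_simps[OF assms]
  show "\<exists>y\<in>carrier (quot_module J E). y \<oplus>\<^bsub>quot_module J E\<^esub> x = \<zero>\<^bsub>quot_module J E\<^esub>"
    if x: "x \<in> carrier (quot_module J E)" for x
  proof -
    obtain t where "x = coset_vec J E t" using x by (auto simp: carrier_quot_module)
    then show ?thesis
      by (intro bexI[of _ "coset_vec J E (\<lambda>e. - t e)"]) (simp_all add: simps)
  qed
qed (auto simp: carrier_quot_module quot_module_simps[OF assms] add_ac)

lemma finsum_quot_module:
  assumes J: "ideal J free_alg" and "finite X"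
  shows "finsum (quot_module J E) (\<lambda>x. coset J (a x) \<odot>\<^bsub>quot_module J E\<^esub> coset_vec J E (f x)) X
    = coset_vec J E (\<lambda>e. \<Sum>x\<in>X. a x * f x e)"
  using assms(2)
proof (induction X rule: finite_induct)
  interpret abelian_group "quot_module J E" by (rule abelian_group_quot_module[OF J])
  case empty
  show ?case by (simp add: quot_module_simps[OF J])
next
  interpret abelian_group "quot_module J E" by (rule abelian_group_quot_module[OF J])
  case (insert x X)
  then show ?case by (subst finsum_insert) (auto simp: quot_module_simps[OF J])
qed

text \<open>
  Spans of classes are described by their representatives: closure under changes modulo \<open>J\<close> is one
  of the generating rules. A transfer of membership between the two algebras then becomes a rule
  induction, and the left and the two-sided case differ in one rule only.
\<close>

inductive_set rep_span :: "bool \<Rightarrow> ('v, 'k::field) ncpoly set \<Rightarrow> 'e set \<Rightarrow>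
    ('e \<Rightarrow> ('v, 'k) ncpoly) set \<Rightarrow> ('e \<Rightarrow> ('v, 'k) ncpoly) set"
  for two_sided :: bool and J E X where
  base: "x \<in> X \<Longrightarrow> x \<in> rep_span two_sided J E X"
| cong: "x \<in> rep_span two_sided J E X \<Longrightarrow> (\<And>e. e \<in> E \<Longrightarrow> x e - y e \<in> J) \<Longrightarrow>
    y \<in> rep_span two_sided J E X"
| zero: "(\<lambda>_. 0) \<in> rep_span two_sided J E X"
| add: "x \<in> rep_span two_sided J E X \<Longrightarrow> y \<in> rep_span two_sided J E X \<Longrightarrow>
    (\<lambda>e. x e + y e) \<in> rep_span two_sided J E X"
| left: "x \<in> rep_span two_sided J E X \<Longrightarrow> (\<lambda>e. p * x e) \<in> rep_span two_sided J E X"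
| right: "two_sided \<Longrightarrow> x \<in> rep_span two_sided J E X \<Longrightarrow>
    (\<lambda>e. x e * p) \<in> rep_span two_sided J E X"

definition span where
  "span two_sided R E X = (if two_sided then two_sided_span R E X else left_span R E X)"

lemma span_conv: "span two_sided R E X = \<Inter>{N. submodule N R (free_module R E) \<and>
    (two_sided \<longrightarrow> (\<forall>a\<in>carrier R. \<forall>x\<in>N. (\<lambda>e\<in>E. x e \<otimes>\<^bsub>R\<^esub> a) \<in> N)) \<and> X \<subseteq> N}"
  by (simp add: span_def left_span_def two_sided_span_def)

lemma submodule_quot_moduleI:
  assumes J: "ideal J free_alg" and "N \<subseteq> carrier (quot_module J E)"
    and "coset_vec J E (\<lambda>_. 0) \<in> N"
    and "\<And>s t. coset_vec J E s \<in> N \<Longrightarrow> coset_vec J E t \<in> N \<Longrightarrow> coset_vec J E (\<lambda>e. s e + t e) \<in> N"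
    and smult: "\<And>p t. coset_vec J E t \<in> N \<Longrightarrow> coset_vec J E (\<lambda>e. p * t e) \<in> N"
  shows "submodule N (free_alg Quot J) (quot_module J E)"
proof -
  interpret abelian_group "quot_module J E" by (rule abelian_group_quot_module[OF J])
  have vec: "\<exists>t. x = coset_vec J E t" if "x \<in> N" for x
    using that assms(2) by (auto simp: carrier_quot_module)
  show ?thesis
  proof (intro submodule.intro submodule_axioms.intro)
    show "subgroup N (add_monoid (quot_module J E))"
    proof (rule group.subgroupI[OF a_group])
      show "inv\<^bsub>add_monoid (quot_module J E)\<^esub> x \<in> N" if x: "x \<in> N" for x
      proof -
        obtain t where t: "x = coset_vec J E t" using vec x by blast
        have "\<ominus>\<^bsub>quot_module J E\<^esub> x = coset_vec J E (\<lambda>e. - t e)"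
          by (rule minus_equality) (auto simp: t quot_module_simps[OF J])
        then show ?thesis using smult[of t "- 1"] x by (simp add: a_inv_def t)
      qed
      show "x \<otimes>\<^bsub>add_monoid (quot_module J E)\<^esub> y \<in> N" if "x \<in> N" "y \<in> N" for x y
        using vec[OF that(1)] vec[OF that(2)] that assms(4) by (auto simp: quot_module_simps[OF J])
    qed (use assms in auto)
    show "a \<odot>\<^bsub>quot_module J E\<^esub> x \<in> N" if "a \<in> carrier (free_alg Quot J)" "x \<in> N" for a x
      using vec[OF that(2)] that smult by (auto simp: carrier_Quot quot_module_simps[OF J])
  qed
qed

lemma coset_vec_mem_span_iff:
  assumes J: "ideal J free_alg"
  shows "coset_vec J E t \<in> span two (free_alg Quot J) E (coset_vec J E ` X) \<longleftrightarrow>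
    t \<in> rep_span two J E X"
proof
  let ?N = "coset_vec J E ` rep_span two J E X"
  have mem: "coset_vec J E s \<in> ?N \<longleftrightarrow> s \<in> rep_span two J E X" for s
  proof
    assume "coset_vec J E s \<in> ?N"
    then obtain s' where s': "s' \<in> rep_span two J E X" "coset_vec J E s' = coset_vec J E s"
      by auto
    then show "s \<in> rep_span two J E X"
      by (intro rep_span.cong[OF s'(1)]) (simp add: coset_vec_eq_iff[OF J])
  qed simp
  have "submodule ?N (free_alg Quot J) (quot_module J E)"
    by (rule submodule_quot_moduleI[OF J]) (auto simp only: mem intro: rep_span.intros, auto)
  moreover have "(\<lambda>e\<in>E. x e \<otimes>\<^bsub>free_alg Quot J\<^esub> a) \<in> ?N"
    if "two" "a \<in> carrier (free_alg Quot J)" "x \<in> ?N" for a x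
    using that by (auto simp: carrier_Quot quot_module_simps[OF J] intro: rep_span.right)
  moreover have "coset_vec J E ` X \<subseteq> ?N" by (auto intro: rep_span.base)
  ultimately have "span two (free_alg Quot J) E (coset_vec J E ` X) \<subseteq> ?N"
    unfolding span_conv by (intro Inter_lower) blast
  then show "t \<in> rep_span two J E X"
    if "coset_vec J E t \<in> span two (free_alg Quot J) E (coset_vec J E ` X)"
    using that mem by blast
next
  assume t: "t \<in> rep_span two J E X"
  show "coset_vec J E t \<in> span two (free_alg Quot J) E (coset_vec J E ` X)"
    unfolding span_conv
  proof (intro InterI, clarify)
    fix N assume sub: "submodule N (free_alg Quot J) (quot_module J E)"
      and right: "two \<longrightarrow> (\<forall>a\<in>carrier (free_alg Quot J). \<forall>x\<in>N. (\<lambda>e\<in>E. x e \<otimes>\<^bsub>free_alg Quot J\<^esub> a) \<in> N)"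
      and X: "coset_vec J E ` X \<subseteq> N"
    interpret submodule N "free_alg Quot J" "quot_module J E" by (rule sub)
    from t show "coset_vec J E t \<in> N"
    proof (induction rule: rep_span.induct)
      case (base x)
      then show ?case using X by blast
    next
      case (cong x y)
      then show ?case by (metis coset_vec_eq_iff[OF J])
    next
      case zero
      then show ?case using one_closed by (simp add: quot_module_simps[OF J])
    next
      case (add x y)
      then show ?case using m_closed by (fastforce simp: quot_module_simps[OF J])
    next
      case (left x p)
      then show ?case
        using smult_closed[of "coset J p" "coset_vec J E x"] by (simp add: quot_module_simps[OF J])
    next
      case (right x p)
      then show ?case
        using \<open>two \<longrightarrow> _\<close> coset_mem_carrier[of J p] quot_module_simps(4)[OF J, of E x p] by metis
    qed
  qed
qed

section \<open>Rewriting words to standard form\<close>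

text \<open>
  Multiplication by words from both sides acts on words; this locates the words that a replacement
  introduces.
\<close>

lemma word_mult_word_conv_lin: "word u * p * word v = lin (\<lambda>m. word (u @ m @ v)) p"
  by (induction p rule: ncpoly_induct)
    (simp_all add: distrib_left distrib_right lin_add lin_scal word_append word_scal_commute
      mult.assoc)

lemma word_mult_conv_lin: "word u * p = lin (\<lambda>m. word (u @ m)) p"
  using word_mult_word_conv_lin[of u p "[]"] by simp

lemma not_sorted_descent:
  assumes "\<not> sorted (u :: 'a::linorder list)"
  obtains m j i m' where "u = m @ [j, i] @ m'" "i < j"
proof -
  obtain n where n: "Suc n < length u" "u ! Suc n < u ! n"
    using assms by (auto simp: sorted_iff_nth_Suc not_le)
  then have "u = take n u @ [u ! n, u ! Suc n] @ drop (Suc (Suc n)) u"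
    by (metis Cons_nth_drop_Suc Suc_lessD append_Cons append_Nil append_take_drop_id)
  with n show ?thesis using that by blast
qed

lemma wf_less_finite: "wf {(a, b :: 'a::{finite,linorder}). a < b}"
proof (rule finite_acyclic_wf)
  have "trans {(a, b :: 'a). a < b}" by (auto intro: transI)
  then show "acyclic {(a, b :: 'a). a < b}" by (simp add: acyclic_def)
qed simp

lemma mult_mset_set:
  assumes "finite A" "finite B" "B - A \<noteq> {}" "\<And>x. x \<in> A - B \<Longrightarrow> \<exists>y\<in>B - A. (x, y) \<in> r"
  shows "(mset_set A, mset_set B) \<in> mult r"
proof -
  have "mset_set X = mset_set (X \<inter> Y) + mset_set (X - Y)" if "finite X" for X Y :: "'a set"
    using that mset_set_Union[of "X \<inter> Y" "X - Y"] by (simp add: Int_Diff_Un Int_Diff_disjoint)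
  from this[of A B] this[of B A] show ?thesis
    using assms one_step_implies_mult[of "mset_set (B - A)" "mset_set (A - B)" r "mset_set (A \<inter> B)"]
    by (auto simp: Int_commute mset_set_empty_iff)
qed

text \<open>
  Every replacement of \<open>x\<^sub>j x\<^sub>i\<close> by \<open>c\<^sub>i\<^sub>j x\<^sub>i x\<^sub>j + d\<^sub>i\<^sub>j\<close> inside a word either keeps the exponent and
  sorts an inversion, or lowers the exponent. If the order on exponents is well-founded, then so is
  the resulting order on words.
\<close>

locale reduction_system =
  fixes c :: "'v::{finite,linorder} \<Rightarrow> 'v \<Rightarrow> 'k::field"
    and d :: "'v \<Rightarrow> 'v \<Rightarrow> ('v, 'k) ncpoly"
    and lt :: "'v expo \<Rightarrow> 'v expo \<Rightarrow> bool"
  assumes mo: "monomial_order lt"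
    and wf_lt: "wf {(\<alpha>, \<beta>). lt \<alpha> \<beta>}"
    and c_nonzero: "i < j \<Longrightarrow> c i j \<noteq> 0"
    and d_less: "i < j \<Longrightarrow> u \<in> keys (d i j) \<Longrightarrow> lt (expo u) (single i 1 + single j 1)"
begin

definition word_less :: "('v list \<times> 'v list) set" where
  "word_less = inv_image ({(\<alpha>, \<beta>). lt \<alpha> \<beta>} <*lex*> lenlex {(a, b). a < b}) (\<lambda>u. (expo u, u))"

lemma wf_word_less: "wf word_less"
  unfolding word_less_def by (intro wf_inv_image wf_lex_prod wf_lt wf_lenlex wf_less_finite)

lemma word_less_expo: "lt (expo u) (expo v) \<Longrightarrow> (u, v) \<in> word_less"
  by (simp add: word_less_def)

lemma lt_add_left: "lt \<alpha> \<beta> \<Longrightarrow> lt (\<gamma> + \<alpha>) (\<gamma> + \<beta>)"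
  using monomial_orderD(4)[OF mo, of \<alpha> \<beta> \<gamma>] by (simp add: add.commute)

lemma expo_tail_less:
  assumes "i < j" "v \<in> keys (d i j)"
  shows "lt (expo (m @ v @ m')) (expo (m @ [j, i] @ m'))"
proof -
  have "lt (expo m + (expo v + expo m')) (expo m + (single i 1 + single j 1 + expo m'))"
    by (intro lt_add_left monomial_orderD(4)[OF mo] d_less assms)
  then show ?thesis by (simp add: add_ac)
qed

lemma word_less_swap:
  assumes "i < j"
  shows "(m @ [i, j] @ m', m @ [j, i] @ m') \<in> word_less"
proof -
  have "(m @ [i, j] @ m', m @ [j, i] @ m') \<in> lenlex {(a, b). a < b}"
    using assms by (auto simp: lenlex_conv lex_conv intro!: exI[of _ m])
  then show ?thesis by (simp add: word_less_def add_ac)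
qed

lemma word_less_replacement:
  assumes "i < j"
    and "v \<in> keys (word m * (scal (c i j) * word [i, j] + d i j) * word m')"
  shows "(v, m @ [j, i] @ m') \<in> word_less"
proof -
  let ?q = "scal (c i j) * word [i, j] + d i j"
  obtain u where u: "u \<in> keys ?q" "v = m @ u @ m'"
    using assms(2) keys_lin[of "\<lambda>u. word (m @ u @ m')" ?q]
    by (auto simp: word_mult_word_conv_lin)
  then consider "u = [i, j]" | "u \<in> keys (d i j)"
    using Poly_Mapping.keys_add[of "scal (c i j) * word [i, j]" "d i j"]
      keys_scal_mult[of "c i j" "word [i, j]"] by auto
  then show ?thesis
    using u(2) word_less_swap assms(1) word_less_expo[OF expo_tail_less] by cases auto
qed

text \<open>
  One replacement removes a word from the set of non-standard words and adds only smaller ones, so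
  this set decreases in the multiset order.
\<close>

lemma replacement_terminates: "\<exists>q\<in>std_polys. (replacement c d)\<^sup>*\<^sup>* p q"
proof -
  define bad where "bad p = {u \<in> keys p. \<not> sorted u}" for p :: "('v, 'k) ncpoly"
  have "wf (inv_image (mult word_less) (mset_set \<circ> bad))"
    by (intro wf_inv_image wf_mult wf_word_less)
  then show ?thesis
  proof (induction p rule: wf_induct_rule)
    case (less p)
    show ?case
    proof (cases "bad p = {}")
      case True
      then have "p \<in> std_polys" by (auto simp: bad_def std_polys_iff)
      then show ?thesis by blast
    next
      case False
      then obtain u where u: "u \<in> keys p" "\<not> sorted u" by (auto simp: bad_def)
      obtain m j i m' where ij: "u = m @ [j, i] @ m'" "i < j"
        using not_sorted_descent[OF u(2)] .
      define r where "r = word m * (scal (c i j) * word [i, j] + d i j) * word m'"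
      define q where "q = p - scal (lookup p u) * word u + scal (lookup p u) * r"
      have step: "replacement c d p q"
        using ij unfolding replacement_def q_def r_def Let_def by (auto simp: mult.assoc)
      have r: "(v, u) \<in> word_less" if "v \<in> keys r" for v
        using word_less_replacement[OF ij(2), of v m m'] that ij by (simp add: r_def)
      have q: "v \<in> keys p \<or> (v, u) \<in> word_less" "v \<noteq> u" if v: "v \<in> keys q" for v
      proof -
        have "lookup q v = lookup p v - lookup p u * (if u = v then 1 else 0) + lookup p u * lookup r v"
          by (simp add: q_def lookup_add lookup_minus lookup_word)
        moreover have "lookup q v \<noteq> 0" using v by (simp add: in_keys_iff)
        moreover have "lookup r u = 0"
          using r[of u] wf_word_less by (auto simp: in_keys_iff)
        ultimately show "v \<in> keys p \<or> (v, u) \<in> word_less" "v \<noteq> u"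
          using r[of v] by (auto simp: in_keys_iff split: if_splits)
      qed
      have "(mset_set (bad q), mset_set (bad p)) \<in> mult word_less"
      proof (rule mult_mset_set)
        have "u \<in> bad p - bad q" using u q(2) by (auto simp: bad_def)
        then show "bad p - bad q \<noteq> {}" by blast
        show "\<exists>y\<in>bad p - bad q. (v, y) \<in> word_less" if "v \<in> bad q - bad p" for v
          using that q(1)[of v] \<open>u \<in> bad p - bad q\<close> by (auto simp: bad_def)
      qed (simp_all add: bad_def)
      then obtain q' where "q' \<in> std_polys" "(replacement c d)\<^sup>*\<^sup>* q q'"
        using less.IH[of q] by auto
      then show ?thesis using step by (blast intro: converse_rtranclp_into_rtranclp)
    qed
  qed
qed

end

locale reduction_ideal = reduction_system +
  fixes J
  assumes ideal_J: "ideal J free_alg"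
    and relations_subset: "relations c d \<subseteq> J"
begin

lemma replacement_mem:
  assumes "i < j"
  shows "word (m @ [j, i] @ m') - word m * (scal (c i j) * word [i, j] + d i j) * word m' \<in> J"
proof -
  have "word [j, i] - scal (c i j) * word [i, j] - d i j \<in> J"
    using assms relations_subset by (auto simp: relations_def)
  then have "word m * (word [j, i] - scal (c i j) * word [i, j] - d i j) * word m' \<in> J"
    by (intro ideal_mult_left[OF ideal_J] ideal_mult_right[OF ideal_J])
  then show ?thesis
    by (simp only: word_append) (simp add: algebra_simps)
qed

text \<open>
  A replacement multiplies the word with its two letters swapped by \<open>c\<^sub>i\<^sub>j\<close>, which is nonzero, and adds
  words of smaller exponent. Hence the coefficient of the standard word with the same exponent stays
  nonzero all the way.
\<close>

lemma word_standard_form: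
  "\<exists>q\<in>std_polys. word u - q \<in> J \<and> lookup q (std_word (expo u)) \<noteq> 0 \<and>
    (\<forall>\<beta>\<in>supp q. \<beta> = expo u \<or> lt \<beta> (expo u))"
  using wf_word_less
proof (induction u rule: wf_induct_rule)
  case (less u)
  show ?case
  proof (cases "sorted u")
    case True
    then show ?thesis
      by (intro bexI[of _ "word u"])
        (auto simp: ideal_0[OF ideal_J] std_word_expo lookup_word std_sorted_word supp_def
          split: if_splits)
  next
    case False
    then obtain m j i m' where ij: "u = m @ [j, i] @ m'" "i < j"
      using not_sorted_descent by blast
    have exp: "expo (m @ [i, j] @ m') = expo u" by (simp add: ij add_ac)
    obtain q where q: "q \<in> std_polys" "word (m @ [i, j] @ m') - q \<in> J"
      "lookup q (std_word (expo u)) \<noteq> 0" "\<And>\<beta>. \<beta> \<in> supp q \<Longrightarrow> \<beta> = expo u \<or> lt \<beta> (expo u)"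
      using less.IH[of "m @ [i, j] @ m'"] word_less_swap[OF ij(2), of m m'] ij(1)
      unfolding exp by blast
    have "\<exists>g\<in>std_polys. word (m @ v @ m') - g \<in> J \<and> (\<forall>\<beta>\<in>supp g. lt \<beta> (expo u))"
      if v: "v \<in> keys (d i j)" for v
    proof -
      have lt: "lt (expo (m @ v @ m')) (expo u)"
        using expo_tail_less[OF ij(2) v] ij(1) by simp
      obtain g where g: "g \<in> std_polys" "word (m @ v @ m') - g \<in> J"
        "\<forall>\<beta>\<in>supp g. \<beta> = expo (m @ v @ m') \<or> lt \<beta> (expo (m @ v @ m'))"
        using less.IH[OF word_less_expo[OF lt]] by auto
      then have "\<forall>\<beta>\<in>supp g. lt \<beta> (expo u)"
        using lt monomial_orderD(1)[OF mo] by (metis transpD)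
      with g show ?thesis by blast
    qed
    then obtain f where f: "\<And>v. v \<in> keys (d i j) \<Longrightarrow> f v \<in> std_polys"
      "\<And>v. v \<in> keys (d i j) \<Longrightarrow> word (m @ v @ m') - f v \<in> J"
      "\<And>v \<beta>. v \<in> keys (d i j) \<Longrightarrow> \<beta> \<in> supp (f v) \<Longrightarrow> lt \<beta> (expo u)"
      by metis
    define g where "g = lin f (d i j)"
    have g_std: "g \<in> std_polys" unfolding g_def by (intro std_lin f)
    have g_less: "lt \<beta> (expo u)" if "\<beta> \<in> supp g" for \<beta>
      using that keys_lin[of f "d i j"] f(3) by (fastforce simp: g_def mem_supp)
    have tail: "word m * d i j * word m' - g \<in> J"
    proof -
      have "word m * d i j * word m' - g = (\<Sum>v\<in>keys (d i j).
          scal (lookup (d i j) v) * (word (m @ v @ m') - f v))"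
        by (simp add: word_mult_word_conv_lin g_def lin_def right_diff_distrib sum_subtractf)
      then show ?thesis
        using f(2) by (auto intro!: ideal_sum[OF ideal_J] ideal_mult_left[OF ideal_J])
    qed
    let ?q = "scal (c i j) * q + g"
    have "word u - ?q = (word u - word m * (scal (c i j) * word [i, j] + d i j) * word m') +
        (scal (c i j) * (word (m @ [i, j] @ m') - q) + (word m * d i j * word m' - g))"
      by (simp only: word_append) (simp add: algebra_simps word_scal_commute)
    moreover have "\<dots> \<in> J"
      using replacement_mem[OF ij(2), of m m'] q(2) tail
      by (intro ideal_add[OF ideal_J] ideal_mult_left[OF ideal_J]) (simp_all add: ij(1))
    ultimately have "word u - ?q \<in> J" by (simp only:)
    moreover have "lookup g (std_word (expo u)) = 0"
      using g_less[of "expo u"] monomial_orderD(2)[OF mo]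
      by (auto simp: mem_supp in_keys_iff irreflp_def)
    then have "lookup ?q (std_word (expo u)) \<noteq> 0"
      using q(3) c_nonzero[OF ij(2)] by (simp add: lookup_add)
    moreover have "\<forall>\<beta>\<in>supp ?q. \<beta> = expo u \<or> lt \<beta> (expo u)"
      using supp_add[of "scal (c i j) * q" g] supp_scal[of "c i j" q] q(4) g_less by blast
    moreover have "?q \<in> std_polys" by (intro std_add std_scal q(1) g_std)
    ultimately show ?thesis by blast
  qed
qed

lemma lin_diff_mem:
  assumes "\<And>m. m \<in> keys p \<Longrightarrow> f m - g m \<in> J"
  shows "lin f p - lin g p \<in> J"
proof -
  have "lin f p - lin g p = (\<Sum>m\<in>keys p. scal (lookup p m) * (f m - g m))"
    by (simp add: lin_def right_diff_distrib sum_subtractf)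
  then show ?thesis
    using assms by (auto intro!: ideal_sum[OF ideal_J] ideal_mult_left[OF ideal_J])
qed

lemma standard_form:
  obtains q where "q \<in> std_polys" "p - q \<in> J"
proof -
  obtain f where f: "\<And>m. f m \<in> std_polys" "\<And>m. word m - f m \<in> J"
    using word_standard_form by metis
  show ?thesis
  proof (rule that[of "lin f p"])
    show "lin f p \<in> std_polys" by (intro std_lin f)
    show "p - lin f p \<in> J"
      using lin_diff_mem[of p word f] f(2) by (simp add: lin_word_id)
  qed
qed

text \<open>
  Multiplying by a standard monomial and returning to standard form adds the exponents of the leading
  monomials, because the coefficient of the leading term stays nonzero and the other terms stay
  smaller.
\<close>

lemma lexps_add:
  assumes "\<alpha> \<in> lexps lt (J \<inter> std_polys)"
  shows "\<alpha> + \<gamma> \<in> lexps lt (J \<inter> std_polys)"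
proof -
  obtain f where f: "f \<in> J" "f \<in> std_polys" "\<alpha> \<in> supp f"
    "\<And>\<beta>. \<beta> \<in> supp f \<Longrightarrow> \<beta> = \<alpha> \<or> lt \<beta> \<alpha>"
    using assms by (auto simp: lexps_def lexp_eq_Some[OF mo])
  obtain q where q: "\<And>u. q u \<in> std_polys" "\<And>u. word u - q u \<in> J"
    "\<And>u. lookup (q u) (std_word (expo u)) \<noteq> 0"
    "\<And>u \<beta>. \<beta> \<in> supp (q u) \<Longrightarrow> \<beta> = expo u \<or> lt \<beta> (expo u)"
    using word_standard_form by metis
  let ?g = "\<lambda>u. q (std_word \<gamma> @ u)"
  have "word (std_word \<gamma>) * f - lin ?g f \<in> J"
    unfolding word_mult_conv_lin by (intro lin_diff_mem q)
  then have J: "lin ?g f \<in> J"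
    using ideal_diff[OF ideal_J ideal_mult_left[OF ideal_J f(1), of "word (std_word \<gamma>)"]]
    by fastforce
  have less: "lt (expo (std_word \<gamma> @ u)) (\<alpha> + \<gamma>)" if "u \<in> keys f" "u \<noteq> std_word \<alpha>" for u
  proof -
    have "expo u \<noteq> \<alpha>" using that f(2) std_word_expo by (metis std_polys_iff)
    then have "lt (expo u) \<alpha>" using f(4)[OF expo_mem_supp[OF f(2) that(1)]] by blast
    then show ?thesis using lt_add_left[of "expo u" \<alpha> \<gamma>] by (simp add: add.commute)
  qed
  have not: "\<not> lt (\<alpha> + \<gamma>) (\<alpha> + \<gamma>)" using monomial_orderD(2)[OF mo] by (simp add: irreflp_def)
  have trans: "lt x z" if "lt x y" "lt y z" for x y z
    using monomial_orderD(1)[OF mo] that by (rule transpD)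
  have supp_g: "\<beta> = \<alpha> + \<gamma> \<or> lt \<beta> (\<alpha> + \<gamma>)" if \<beta>: "\<beta> \<in> supp (?g u)" and u: "u \<in> keys f" for \<beta> u
  proof (cases "u = std_word \<alpha>")
    case True
    then show ?thesis using q(4)[OF \<beta>] by (simp add: add.commute)
  next
    case False
    then show ?thesis using q(4)[OF \<beta>] less[OF u] trans by metis
  qed
  let ?e = "std_word (\<alpha> + \<gamma>)"
  have zero: "lookup (?g u) ?e = 0" if "u \<in> keys f" "u \<noteq> std_word \<alpha>" for u
  proof (rule ccontr)
    assume "lookup (?g u) ?e \<noteq> 0"
    then have "\<alpha> + \<gamma> = expo (std_word \<gamma> @ u) \<or> lt (\<alpha> + \<gamma>) (expo (std_word \<gamma> @ u))"
      by (intro q(4)) (simp add: supp_def)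
    then show False using less[OF that] not trans by metis
  qed
  have \<alpha>: "std_word \<alpha> \<in> keys f" using f(3) by (simp add: mem_supp)
  have "lookup (lin ?g f) ?e = (\<Sum>u\<in>keys f. lookup f u * lookup (?g u) ?e)"
    by (simp add: lin_def lookup_sum)
  also have "\<dots> = (\<Sum>u\<in>{std_word \<alpha>}. lookup f u * lookup (?g u) ?e)"
    by (rule sum.mono_neutral_right) (use \<alpha> zero in auto)
  also have "\<dots> \<noteq> 0"
    using \<alpha> q(3)[of "std_word \<gamma> @ std_word \<alpha>"] by (simp add: in_keys_iff add.commute)
  finally have "\<alpha> + \<gamma> \<in> supp (lin ?g f)" by (simp add: supp_def)
  moreover have "\<beta> = \<alpha> + \<gamma> \<or> lt \<beta> (\<alpha> + \<gamma>)" if "\<beta> \<in> supp (lin ?g f)" for \<beta>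
  proof -
    obtain u where "u \<in> keys f" "\<beta> \<in> supp (?g u)"
      using \<open>\<beta> \<in> supp (lin ?g f)\<close> keys_lin[of ?g f] by (auto simp: mem_supp)
    then show ?thesis using supp_g by blast
  qed
  ultimately have "lexp lt (lin ?g f) = Some (\<alpha> + \<gamma>)" by (simp add: lexp_eq_Some[OF mo])
  moreover have "lin ?g f \<in> std_polys" by (intro std_lin q)
  ultimately show ?thesis using J by (auto simp: lexps_def)
qed

end

section \<open>Dickson's lemma\<close>

text \<open>
  There are arbitrarily large indices whose value is at most every later value: beyond any index, take
  one where the minimum of the remaining values is attained.
\<close>

lemma mono_subsequence_nat:
  fixes f :: "nat \<Rightarrow> nat"
  obtains r :: "nat \<Rightarrow> nat" where "strict_mono r" "mono (f \<circ> r)"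
proof -
  let ?X = "{n. \<forall>k\<ge>n. f n \<le> f k}"
  have "\<exists>n\<ge>N. n \<in> ?X" for N
  proof -
    obtain n where "n \<ge> N" "\<And>k. k \<ge> N \<Longrightarrow> f n \<le> f k"
      using ex_has_least_nat[of "\<lambda>n. n \<ge> N" N f] by auto
    then show ?thesis by auto
  qed
  then have "infinite ?X" by (simp add: infinite_nat_iff_unbounded_le)
  then have "strict_mono (enumerate ?X)" "\<And>n. enumerate ?X n \<in> ?X"
    by (auto intro: strict_mono_enumerate dest: enumerate_in_set)
  then show ?thesis
    by (intro that[of "enumerate ?X"])
      (auto simp: mono_def strict_mono_less_eq)
qed

lemma mono_subsequence_family:
  fixes f :: "'a \<Rightarrow> nat \<Rightarrow> nat"
  assumes "finite X"
  shows "\<exists>r :: nat \<Rightarrow> nat. strict_mono r \<and> (\<forall>i\<in>X. mono (f i \<circ> r))"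
  using assms
proof (induction X rule: finite_induct)
  case empty
  show ?case by (rule exI[of _ "\<lambda>n::nat. n"]) (simp add: strict_mono_def)
next
  case (insert x X)
  then obtain r :: "nat \<Rightarrow> nat" where r: "strict_mono r" "\<forall>i\<in>X. mono (f i \<circ> r)" by blast
  obtain s :: "nat \<Rightarrow> nat" where s: "strict_mono s" "mono (f x \<circ> r \<circ> s)"
    using mono_subsequence_nat[of "f x \<circ> r"] .
  have "mono (f i \<circ> (r \<circ> s))" if "i \<in> insert x X" for i
    using that r(2) s strict_mono_mono[OF s(1)] by (auto simp: mono_def o_def)
  moreover have "strict_mono (r \<circ> s)" using r(1) s(1) by (simp add: strict_mono_def)
  ultimately show ?case by blast
qed

text \<open>
  In an infinite set of minimal elements, any sequence of distinct elements would have a subsequence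
  that is nondecreasing in every coordinate, which contradicts minimality.
\<close>

lemma dickson:
  fixes T :: "'v::finite expo set"
  obtains F where "finite F" "F \<subseteq> T" "\<And>t. t \<in> T \<Longrightarrow> \<exists>f\<in>F. \<exists>\<gamma>. t = f + \<gamma>"
proof
  define le :: "'v expo \<Rightarrow> 'v expo \<Rightarrow> bool"
    where "le s t \<longleftrightarrow> (\<forall>i. lookup s i \<le> lookup t i)" for s t
  define F where "F = {t \<in> T. \<forall>s\<in>T. le s t \<longrightarrow> s = t}"
  show "finite F"
  proof (rule ccontr)
    assume "infinite F"
    then obtain f :: "nat \<Rightarrow> 'v expo" where f: "inj f" "range f \<subseteq> F"
      using infinite_countable_subset by blast
    obtain r :: "nat \<Rightarrow> nat" where r: "strict_mono r" "\<And>i. mono ((\<lambda>n. lookup (f n) i) \<circ> r)"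
      using mono_subsequence_family[of UNIV "\<lambda>i n. lookup (f n) i"] by auto
    have "le (f (r 0)) (f (r 1))"
      using r(2) by (auto simp: le_def mono_def)
    moreover have "f (r 0) \<in> F" "f (r 1) \<in> F" using f(2) by blast+
    ultimately have "f (r 0) = f (r 1)" by (auto simp: F_def)
    then show False
      using injD[OF f(1)] r(1) by (metis less_irrefl strict_mono_less zero_less_one)
  qed
  show "F \<subseteq> T" by (auto simp: F_def)
  have add: "\<exists>\<gamma>. t = s + \<gamma>" if "le s t" for s t
    using that by (intro exI[of _ "t - s"] poly_mapping_eqI)
      (simp add: le_def lookup_add lookup_minus)
  have "\<exists>f\<in>F. le f t" if "t \<in> T" for t
    using that
  proof (induction "\<Sum>i\<in>UNIV. lookup t i" arbitrary: t rule: less_induct)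
    case less
    show ?case
    proof (cases "t \<in> F")
      case True
      then show ?thesis by (auto simp: le_def)
    next
      case False
      then obtain s where s: "s \<in> T" "le s t" "s \<noteq> t" using less.prems by (auto simp: F_def)
      then obtain i where "lookup s i \<noteq> lookup t i" by (metis poly_mapping_eqI)
      then have "lookup s i < lookup t i" using s(2) by (metis le_def le_neq_implies_less)
      then have "(\<Sum>i\<in>UNIV. lookup s i) < (\<Sum>i\<in>UNIV. lookup t i)"
        using s(2) by (intro sum_strict_mono_ex1) (auto simp: le_def)
      from less.hyps[OF this s(1)] show ?thesis
        using s(2) by (metis le_def order_trans)
    qed
  qed
  then show "\<exists>f\<in>F. \<exists>\<gamma>. t = f + \<gamma>" if "t \<in> T" for t using that add by blast
qed

section \<open>Normal forms modulo an ideal\<close>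

text \<open>
  Standard polynomials are reduced modulo an ideal by cancelling leading monomials that occur as
  leading monomials of elements of the ideal.
\<close>

lemma reduced_form_exists:
  assumes mo: "monomial_order lt" and wf: "wf {(\<alpha>, \<beta>). lt \<alpha> \<beta>}" and J: "ideal J free_alg"
    and "p \<in> std_polys"
  shows "\<exists>q\<in>std_polys. p - q \<in> J \<and> supp q \<inter> lexps lt (J \<inter> std_polys) = {}"
proof -
  let ?T = "lexps lt (J \<inter> std_polys)"
  have *: "\<exists>q\<in>std_polys. p - q \<in> J \<and> supp q \<inter> ?T = {}"
    if "p \<in> std_polys" "\<And>\<beta>. \<beta> \<in> supp p \<Longrightarrow> \<beta> = \<alpha> \<or> lt \<beta> \<alpha>" for \<alpha> p
    using wf that
  proof (induction \<alpha> arbitrary: p rule: wf_induct_rule)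
    case (less \<alpha>)
    let ?k = "lookup p (std_word \<alpha>)"
    have red: "\<exists>q\<in>std_polys. p - r - q \<in> J \<and> supp q \<inter> ?T = {}"
      if r: "r \<in> std_polys" "lookup r (std_word \<alpha>) = ?k"
        "\<And>\<beta>. \<beta> \<in> supp r \<Longrightarrow> \<beta> = \<alpha> \<or> lt \<beta> \<alpha>" for r
    proof (cases "supp (p - r) = {}")
      case True
      then have "p - r = 0" using supp_empty std_diff r(1) less.prems(1) by blast
      then show ?thesis using ideal_0[OF J] by (intro bexI[of _ 0]) auto
    next
      case False
      then obtain \<beta> where \<beta>: "lexp lt (p - r) = Some \<beta>"
        by (metis lexp_eq_None not_Some_eq)
      then have \<beta>': "\<beta> \<in> supp (p - r)" "\<And>\<gamma>. \<gamma> \<in> supp (p - r) \<Longrightarrow> \<gamma> = \<beta> \<or> lt \<gamma> \<beta>"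
        by (auto simp: lexp_eq_Some[OF mo])
      have "\<beta> \<noteq> \<alpha>" using \<beta>'(1) r(2) by (auto simp: supp_def lookup_minus)
      moreover have "\<beta> = \<alpha> \<or> lt \<beta> \<alpha>"
        using \<beta>'(1) supp_diff[of p r] r(3) less.prems(2) by blast
      ultimately show ?thesis
        using less.IH[of \<beta> "p - r"] \<beta>'(2) std_diff[OF less.prems(1) r(1)] by auto
    qed
    show ?case
    proof (cases "\<alpha> \<in> ?T")
      case True
      then obtain f where f: "f \<in> J" "f \<in> std_polys" "\<alpha> \<in> supp f"
        "\<And>\<beta>. \<beta> \<in> supp f \<Longrightarrow> \<beta> = \<alpha> \<or> lt \<beta> \<alpha>"
        by (auto simp: lexps_def lexp_eq_Some[OF mo])
      define r where "r = scal (?k / lookup f (std_word \<alpha>)) * f"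
      have "\<exists>q\<in>std_polys. p - r - q \<in> J \<and> supp q \<inter> ?T = {}"
      proof (rule red)
        show "r \<in> std_polys" unfolding r_def by (rule std_scal[OF f(2)])
        show "lookup r (std_word \<alpha>) = ?k" using f(3) by (simp add: r_def supp_def)
        show "\<beta> = \<alpha> \<or> lt \<beta> \<alpha>" if "\<beta> \<in> supp r" for \<beta>
          using that f(4) supp_scal unfolding r_def by blast
      qed
      then obtain q where q: "q \<in> std_polys" "p - r - q \<in> J" "supp q \<inter> ?T = {}" by blast
      have "r \<in> J" unfolding r_def by (rule ideal_mult_left[OF J f(1)])
      then have "(p - r - q) + r \<in> J" using q(2) by (intro ideal_add[OF J])
      then have "p - q \<in> J" by (simp add: algebra_simps)
      with q show ?thesis by blast
    next
      case False
      define r where "r = scal ?k * word (std_word \<alpha>)"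
      have r: "supp r \<subseteq> {\<alpha>}"
        using injD[OF inj_std_word] by (auto simp: r_def supp_def lookup_word split: if_splits)
      have r_std: "r \<in> std_polys"
        unfolding r_def by (intro std_scal std_sorted_word sorted_std_word)
      have "\<exists>q\<in>std_polys. p - r - q \<in> J \<and> supp q \<inter> ?T = {}"
        by (rule red[OF r_std]) (use r in \<open>auto simp: r_def lookup_word\<close>)
      then obtain q where q: "q \<in> std_polys" "p - r - q \<in> J" "supp q \<inter> ?T = {}" by blast
      have "supp (r + q) \<inter> ?T = {}" using supp_add[of r q] r q(3) False by blast
      moreover have "p - (r + q) \<in> J" using q(2) by (simp add: algebra_simps)
      ultimately show ?thesis using std_add[OF r_std q(1)] by blast
    qed
  qed
  show ?thesis
  proof (cases "lexp lt p")
    case None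
    then show ?thesis
      using assms(4) ideal_0[OF J] by (intro bexI[of _ p]) (auto simp: lexp_eq_None)
  next
    case (Some \<alpha>)
    then show ?thesis using *[OF assms(4), of \<alpha>] by (simp add: lexp_eq_Some[OF mo])
  qed
qed

lemma std_mem_ideal_eq_0:
  assumes "monomial_order lt" "q \<in> J" "q \<in> std_polys"
    and "supp q \<inter> lexps lt (J \<inter> std_polys) = {}"
  shows "q = 0"
proof (cases "lexp lt q")
  case None
  then show ?thesis using assms supp_empty by (simp add: lexp_eq_None)
next
  case (Some \<alpha>)
  then have "\<alpha> \<in> supp q \<inter> lexps lt (J \<inter> std_polys)"
    using assms by (auto simp: lexp_eq_Some lexps_def)
  then show ?thesis using assms(4) by simp
qed

section \<open>Homogeneous components\<close>

lemma lookup_lin: "lookup (lin f p) m = (\<Sum>u\<in>keys p. lookup p u * lookup (f u) m)"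
  by (simp add: lin_def lookup_sum)

definition hcomp :: "('v \<Rightarrow> nat) \<Rightarrow> nat \<Rightarrow> ('v, 'k::field) ncpoly \<Rightarrow> ('v, 'k) ncpoly" where
  "hcomp w k = lin (\<lambda>m. if wdeg w m = k then word m else 0)"

lemma lookup_hcomp: "lookup (hcomp w k p) m = (if wdeg w m = k then lookup p m else 0)"
proof -
  have "lookup (hcomp w k p) m =
      (\<Sum>u\<in>keys p. if u = m then (if wdeg w m = k then lookup p m else 0) else 0)"
    unfolding hcomp_def lookup_lin by (rule sum.cong) (auto simp: lookup_word)
  also have "\<dots> = (if wdeg w m = k then lookup p m else 0)"
    by (auto simp: in_keys_iff)
  finally show ?thesis .
qed

lemma keys_hcomp: "keys (hcomp w k p) = {m \<in> keys p. wdeg w m = k}"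
  by (auto simp: in_keys_iff lookup_hcomp split: if_splits)

lemma hcomp_homogeneous: "homogeneous w l p \<Longrightarrow> hcomp w k p = (if k = l then p else 0)"
  by (intro poly_mapping_eqI) (auto simp: lookup_hcomp homogeneous_def in_keys_iff)

lemma homogeneous_hcomp: "homogeneous w k (hcomp w k p)"
  by (simp add: homogeneous_def keys_hcomp)

lemma std_hcomp: "p \<in> std_polys \<Longrightarrow> hcomp w k p \<in> std_polys"
  by (simp add: std_polys_iff keys_hcomp)

lemma supp_hcomp: "supp (hcomp w k p) = {\<alpha> \<in> supp p. wdeg w (std_word \<alpha>) = k}"
  by (auto simp: mem_supp keys_hcomp)

lemma hcomp_add: "hcomp w k (p + q) = hcomp w k p + hcomp w k q"
  and hcomp_diff: "hcomp w k (p - q) = hcomp w k p - hcomp w k q"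
  and hcomp_scal: "hcomp w k (scal a * p) = scal a * hcomp w k p"
  and hcomp_0 [simp]: "hcomp w k 0 = 0"
  and hcomp_sum: "hcomp w k (\<Sum>x\<in>X. f x) = (\<Sum>x\<in>X. hcomp w k (f x))"
  by (simp_all add: hcomp_def lin_add lin_diff lin_scal lin_sum)

lemma sum_hcomp: "(\<Sum>k\<in>wdeg w ` keys p. hcomp w k p) = p"
proof (rule poly_mapping_eqI)
  fix m
  have "lookup (\<Sum>k\<in>wdeg w ` keys p. hcomp w k p) m =
      (if wdeg w m \<in> wdeg w ` keys p then lookup p m else 0)"
    by (simp add: lookup_sum lookup_hcomp)
  then show "lookup (\<Sum>k\<in>wdeg w ` keys p. hcomp w k p) m = lookup p m"
    by (auto simp: in_keys_iff)
qed

lemma wdeg_simps [simp]: "wdeg w [] = 0" "wdeg w (i # u) = w i + wdeg w u"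
  "wdeg w (u @ v) = wdeg w u + wdeg w v"
  by (simp_all add: wdeg_def)

lemma hcomp_word: "hcomp w k (word m) = (if wdeg w m = k then word m else 0)"
  by (simp add: hcomp_def)

lemma hcomp_word_mult: "hcomp w k (word u * p) =
    (if wdeg w u \<le> k then word u * hcomp w (k - wdeg w u) p else 0)"
proof (induction p rule: ncpoly_induct)
  case (mono a m)
  have "hcomp w k (word u * (scal a * word m)) = scal a * hcomp w k (word (u @ m))"
    by (simp add: word_scal_commute word_append hcomp_scal)
  then show ?case
    unfolding hcomp_word hcomp_scal by (auto simp: word_append word_scal_commute)
qed (simp_all add: distrib_left hcomp_add)

lemma hcomp_mult_word: "hcomp w k (p * word u) =
    (if wdeg w u \<le> k then hcomp w (k - wdeg w u) p * word u else 0)"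
proof (induction p rule: ncpoly_induct)
  case (mono a m)
  have "hcomp w k (scal a * word m * word u) = scal a * hcomp w k (word (m @ u))"
    by (simp add: mult.assoc word_append hcomp_scal)
  then show ?case
    unfolding hcomp_word hcomp_scal by (auto simp: word_append mult.assoc)
qed (simp_all add: distrib_right hcomp_add)

lemma homogeneous_word: "homogeneous w k (word m) \<longleftrightarrow> wdeg w m = k"
  and homogeneous_diff: "homogeneous w k p \<Longrightarrow> homogeneous w k q \<Longrightarrow> homogeneous w k (p - q)"
  using keys_diff_subset[of p q] by (auto simp: homogeneous_def)

lemma homogeneous_mult:
  assumes "homogeneous w k p" "homogeneous w l q"
  shows "homogeneous w (k + l) (p * q)"
  unfolding homogeneous_def
proof
  fix m assume "m \<in> keys (p * q)"
  then obtain u v where "u \<in> keys p" "v \<in> keys q" "m = u @ v"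
    using keys_mult[of p q] by (auto simp: plus_list_def)
  then show "wdeg w m = k + l" using assms by (simp add: homogeneous_def)
qed

lemma hcomp_mult_homogeneous:
  assumes "homogeneous w l q"
  shows "hcomp w D (p * q) = (if l \<le> D then hcomp w (D - l) p * q else 0)"
proof -
  have "hcomp w D (p * q) = (\<Sum>k\<in>wdeg w ` keys p. hcomp w D (hcomp w k p * q))"
    by (simp flip: hcomp_sum sum_distrib_right add: sum_hcomp)
  also have "\<dots> = (\<Sum>k\<in>wdeg w ` keys p. if D = k + l then hcomp w k p * q else 0)"
    by (intro sum.cong refl hcomp_homogeneous homogeneous_mult homogeneous_hcomp assms)
  also have "\<dots> = (if l \<le> D then hcomp w (D - l) p * q else 0)"
  proof (cases "l \<le> D")
    case True
    have "hcomp w (D - l) p = 0" if "D - l \<notin> wdeg w ` keys p"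
      using that by (intro keys_eq_empty[THEN iffD1]) (force simp: keys_hcomp)
    moreover have "(D = k + l) \<longleftrightarrow> (D - l = k)" for k using True by auto
    ultimately show ?thesis using True by auto
  qed auto
  finally show ?thesis .
qed

section \<open>Homogenization and dehomogenization\<close>

definition strip :: "'v option list \<Rightarrow> 'v list" where
  "strip m = map the (filter (\<lambda>x. x \<noteq> None) m)"

definition lift :: "('v \<Rightarrow> nat) \<Rightarrow> nat \<Rightarrow> 'v list \<Rightarrow> 'v option list" where
  "lift w D m = replicate (D - wdeg w m) None @ map Some m"

lemma strip_simps [simp]: "strip [] = []" "strip (None # u) = strip u"
  "strip (Some i # u) = i # strip u" "strip (u @ v) = strip u @ strip v"
  "strip (replicate n None) = []" "strip (map Some m) = m" "strip (lift w D m) = m"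
  by (simp_all add: strip_def lift_def o_def)

lemma dehom_conv_lin: "dehom = lin (\<lambda>m. word (strip m))"
  by (simp add: fun_eq_iff dehom_def lin_def strip_def)

lemma homog_to_conv_lin: "homog_to w D = lin (\<lambda>m. word (lift w D m))"
  by (simp add: fun_eq_iff homog_to_def lin_def lift_def)

lemma hweight_simps [simp]: "hweight w None = 1" "hweight w (Some i) = w i"
  by (simp_all add: hweight_def)

lemma wdeg_replicate_None [simp]: "wdeg (hweight w) (replicate n None) = n"
  by (induction n) simp_all

lemma wdeg_map_Some [simp]: "wdeg (hweight w) (map Some m) = wdeg w m"
  by (induction m) simp_all

lemma wdeg_lift: "wdeg w m \<le> D \<Longrightarrow> wdeg (hweight w) (lift w D m) = D"
  by (simp add: lift_def)

lemma wdeg_strip: "wdeg w (strip m) \<le> wdeg (hweight w) m"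
proof (induction m)
  case (Cons a m)
  then show ?case by (cases a) simp_all
qed simp

lemma dehom_simps [simp]:
  "dehom 0 = 0" "dehom (p + q) = dehom p + dehom q" "dehom (p - q) = dehom p - dehom q"
  "dehom (scal a * p) = scal a * dehom p" "dehom (word m) = word (strip m)"
  "dehom (\<Sum>x\<in>X. f x) = (\<Sum>x\<in>X. dehom (f x))"
  by (simp_all add: dehom_conv_lin lin_add lin_diff lin_scal lin_sum)

lemma dehom_mult: "dehom (p * q) = dehom p * dehom q"
  by (simp add: dehom_conv_lin lin_mult word_append)

lemma homog_to_simps:
  "homog_to w D 0 = 0" "homog_to w D (p + q) = homog_to w D p + homog_to w D q"
  "homog_to w D (p - q) = homog_to w D p - homog_to w D q"
  "homog_to w D (scal a * p) = scal a * homog_to w D p"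
  "homog_to w D (word m) = word (lift w D m)"
  by (simp_all add: homog_to_conv_lin lin_add lin_diff lin_scal)

lemma dehom_homog_to [simp]: "dehom (homog_to w D p) = p"
  by (induction p rule: ncpoly_induct) (simp_all add: homog_to_simps)

lemma keys_homog_to: "keys (homog_to w D p) \<subseteq> lift w D ` keys p"
  using keys_lin[of "\<lambda>m. word (lift w D m)" p] by (auto simp: homog_to_conv_lin)

lemma keys_dehom: "keys (dehom p) \<subseteq> strip ` keys p"
  using keys_lin[of "\<lambda>m. word (strip m)" p] by (auto simp: dehom_conv_lin)

lemma sorted_lift: "sorted (lift w D m) \<longleftrightarrow> sorted m"
  for m :: "'v::linorder list"
  by (auto simp: lift_def sorted_append sorted_map)

lemma sorted_strip: "sorted m \<Longrightarrow> sorted (strip m)"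
  for m :: "'v::linorder option list"
proof (induction m)
  case (Cons a m)
  then have "sorted (strip m)" "\<forall>x\<in>set m. a \<le> x" by auto
  then show ?case by (cases a) (auto simp: strip_def)
qed simp

lemma std_homog_to: "p \<in> std_polys \<Longrightarrow> homog_to w D p \<in> std_polys"
  using keys_homog_to[of w D p] by (auto simp: std_polys_iff sorted_lift)

lemma std_dehom: "p \<in> std_polys \<Longrightarrow> dehom p \<in> std_polys"
  using keys_dehom[of p] by (auto simp: std_polys_iff sorted_strip)

lemma homogeneous_homog_to:
  "(\<And>m. m \<in> keys p \<Longrightarrow> wdeg w m \<le> D) \<Longrightarrow> homogeneous (hweight w) D (homog_to w D p)"
  using keys_homog_to[of w D p] by (auto simp: homogeneous_def wdeg_lift)

lemma wdeg_le_pdeg: "m \<in> keys p \<Longrightarrow> wdeg w m \<le> pdeg w p"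
  by (simp add: pdeg_def)

lemma pdeg_le_iff: "pdeg w p \<le> D \<longleftrightarrow> (\<forall>m\<in>keys p. wdeg w m \<le> D)"
  by (simp add: pdeg_def)

lemma homog_to_eq_power_mult:
  assumes "pdeg w p \<le> D"
  shows "homog_to w D p = word (replicate (D - pdeg w p) None) * homog w p"
proof -
  have "lift w D m = replicate (D - pdeg w p) None @ lift w (pdeg w p) m" if "m \<in> keys p" for m
    using wdeg_le_pdeg[OF that, of w] assms by (simp add: lift_def flip: replicate_add)
  then show ?thesis
    by (simp add: homog_def homog_to_conv_lin lin_def sum_distrib_left word_append
        word_scal_commute)
qed

lemma homogeneous_homog: "homogeneous (hweight w) (pdeg w p) (homog w p)"
  unfolding homog_def by (rule homogeneous_homog_to) (rule wdeg_le_pdeg)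

lemma dehom_homog [simp]: "dehom (homog w p) = p"
  by (simp add: homog_def)

lemma ideal_PBW_ideal: "ideal (PBW_ideal c d I) free_alg"
  by (simp add: PBW_ideal_def ideal_Idl)

lemma ideal_hom_ideal: "ideal (hom_ideal c d I w) free_alg"
  by (simp add: hom_ideal_def ideal_Idl)

lemma hom_ideal_generators:
  "p \<in> PBW_ideal c d I \<Longrightarrow> homog w p \<in> hom_ideal c d I w"
  "word [None, Some i] - word [Some i, None] \<in> hom_ideal c d I w"
  unfolding hom_ideal_def
  by (rule subsetD[OF Idl_superset], simp, rule subsetD[OF Idl_superset], rule UnI2,
      rule range_eqI[of _ _ i], simp)

text \<open>Modulo the relations \<open>h x\<^sub>i = x\<^sub>i h\<close>, all factors \<open>h\<close> of a word can be moved to its front.\<close>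

lemma word_lift_strip:
  "word m - word (lift w (wdeg (hweight w) m) (strip m)) \<in> hom_ideal c d I w"
proof (induction m)
  case Nil
  then show ?case by (simp add: lift_def ideal_0[OF ideal_hom_ideal])
next
  case (Cons a m)
  note J = ideal_hom_ideal[of c d I w]
  let ?n = "wdeg (hweight w) m - wdeg w (strip m)"
  have rest: "word (a # m) - word (a # lift w (wdeg (hweight w) m) (strip m)) \<in> hom_ideal c d I w"
    using ideal_mult_left[OF J Cons.IH, of "word [a]"]
    by (simp add: right_diff_distrib flip: word_append)
  show ?case
  proof (cases a)
    case None
    then show ?thesis using rest wdeg_strip[of w m] by (simp add: lift_def Suc_diff_le)
  next
    case (Some i)
    have swap: "word (Some i # replicate n None) - word (replicate n None @ [Some i])
      \<in> hom_ideal c d I w" for n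
    proof (induction n)
      case 0
      then show ?case by (simp add: ideal_0[OF J])
    next
      case (Suc n)
      have "(word [Some i, None] - word [None, Some i]) * word (replicate n None)
        \<in> hom_ideal c d I w"
        using ideal_uminus[OF J hom_ideal_generators(2)[of i c d I w]]
        by (intro ideal_mult_right[OF J]) simp
      moreover have "word [None] * (word (Some i # replicate n None) -
          word (replicate n None @ [Some i])) \<in> hom_ideal c d I w"
        by (rule ideal_mult_left[OF J Suc])
      ultimately have "(word [Some i, None] - word [None, Some i]) * word (replicate n None) +
          word [None] * (word (Some i # replicate n None) - word (replicate n None @ [Some i]))
        \<in> hom_ideal c d I w"
        by (rule ideal_add[OF J])
      then show ?case
        by (simp add: left_diff_distrib right_diff_distrib flip: word_append)
    qed
    have "(word (Some i # replicate ?n None) - word (replicate ?n None @ [Some i]))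
        * word (map Some (strip m)) \<in> hom_ideal c d I w"
      by (rule ideal_mult_right[OF J swap])
    then have "word (a # lift w (wdeg (hweight w) m) (strip m)) -
        word (lift w (wdeg (hweight w) (a # m)) (strip (a # m))) \<in> hom_ideal c d I w"
      by (simp add: Some lift_def left_diff_distrib flip: word_append)
    from ideal_add[OF J rest this] show ?thesis by simp
  qed
qed

text \<open>
  Up to commuting \<open>h\<close> with the variables, a homogeneous element of degree \<open>k\<close> is the homogenization of
  its dehomogenization to degree \<open>k\<close>.
\<close>

lemma homogeneous_mem_hom_idealI:
  assumes p: "homogeneous (hweight w) k p" and "dehom p \<in> PBW_ideal c d I"
  shows "p \<in> hom_ideal c d I w"
proof -
  note J = ideal_hom_ideal[of c d I w]
  have "homog_to w k (dehom p) = lin (\<lambda>m. word (lift w k (strip m))) p"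
    by (simp add: dehom_conv_lin homog_to_conv_lin lin_def[of _ p] lin_sum lin_scal)
  then have "p - homog_to w k (dehom p) =
      (\<Sum>m\<in>keys p. scal (lookup p m) * (word m - word (lift w k (strip m))))"
    using lin_word_id[of p] by (simp add: lin_def right_diff_distrib sum_subtractf)
  moreover have "word m - word (lift w k (strip m)) \<in> hom_ideal c d I w" if "m \<in> keys p" for m
    using word_lift_strip[of m w c d I] p that by (simp add: homogeneous_def)
  ultimately have diff: "p - homog_to w k (dehom p) \<in> hom_ideal c d I w"
    by (auto intro!: ideal_sum[OF J] ideal_mult_left[OF J])
  have "pdeg w (dehom p) \<le> k"
    using keys_dehom[of p] p wdeg_strip[of w] by (fastforce simp: pdeg_le_iff homogeneous_def)
  then have "homog_to w k (dehom p) \<in> hom_ideal c d I w"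
    by (simp add: homog_to_eq_power_mult ideal_mult_left[OF J] hom_ideal_generators(1) assms(2))
  from ideal_add[OF J diff this] show ?thesis by simp
qed

text \<open>
  The elements described on the right form an ideal that contains the generators; conversely each
  homogeneous component of such an element lies in the homogenized ideal by the previous lemma. In
  particular the homogenized ideal is homogeneous, \<open>h\<close> is not a zero divisor modulo it, and for a
  homogeneous element membership can be tested after setting \<open>h = 1\<close>.
\<close>

lemma hom_ideal_iff:
  "p \<in> hom_ideal c d I w \<longleftrightarrow> (\<forall>k. dehom (hcomp (hweight w) k p) \<in> PBW_ideal c d I)"
proof
  let ?K = "{p. \<forall>k. dehom (hcomp (hweight w) k p) \<in> PBW_ideal c d I}"
  note J = ideal_PBW_ideal[of c d I]
  have "ideal ?K free_alg"
  proof (rule free_alg_idealI)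
    show "word u * p \<in> ?K" "p * word u \<in> ?K" if "p \<in> ?K" for u p
      using that by (auto simp: hcomp_word_mult hcomp_mult_word dehom_mult ideal_mult_left[OF J]
          ideal_mult_right[OF J] ideal_0[OF J])
  qed (simp_all add: hcomp_add hcomp_scal ideal_closed[OF J])
  moreover have "homog w p \<in> ?K" if "p \<in> PBW_ideal c d I" for p
    using that by (simp add: hcomp_homogeneous[OF homogeneous_homog] ideal_0[OF J])
  moreover have "word [None, Some i] - word [Some i, None] \<in> ?K" for i
    by (simp add: hcomp_diff hcomp_word ideal_0[OF J])
  ultimately have "hom_ideal c d I w \<subseteq> ?K"
    unfolding hom_ideal_def by (intro Idl_minimal) blast+
  then show "\<forall>k. dehom (hcomp (hweight w) k p) \<in> PBW_ideal c d I" if "p \<in> hom_ideal c d I w"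
    using that by blast
next
  assume "\<forall>k. dehom (hcomp (hweight w) k p) \<in> PBW_ideal c d I"
  then have "hcomp (hweight w) k p \<in> hom_ideal c d I w" for k
    by (intro homogeneous_mem_hom_idealI[OF homogeneous_hcomp]) simp
  then show "p \<in> hom_ideal c d I w"
    using ideal_sum[OF ideal_hom_ideal, of _ "\<lambda>k. hcomp (hweight w) k p"] sum_hcomp by metis
qed

lemma hcomp_mem_hom_ideal:
  "p \<in> hom_ideal c d I w \<Longrightarrow> hcomp (hweight w) k p \<in> hom_ideal c d I w"
  by (intro homogeneous_mem_hom_idealI[OF homogeneous_hcomp]) (simp add: hom_ideal_iff)

lemma dehom_mem_PBW_ideal:
  assumes "p \<in> hom_ideal c d I w"
  shows "dehom p \<in> PBW_ideal c d I"
proof -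
  have "dehom p = (\<Sum>k\<in>wdeg (hweight w) ` keys p. dehom (hcomp (hweight w) k p))"
    by (simp add: sum_hcomp flip: dehom_simps(6))
  also have "\<dots> \<in> PBW_ideal c d I"
    using assms by (intro ideal_sum[OF ideal_PBW_ideal]) (simp add: hom_ideal_iff)
  finally show ?thesis .
qed

section \<open>The homogenized ordering\<close>

definition hdeg :: "('v::finite \<Rightarrow> nat) \<Rightarrow> 'v option expo \<Rightarrow> nat" where
  "hdeg w \<delta> = lookup \<delta> None + (\<Sum>i\<in>UNIV. w i * lookup \<delta> (Some i))"

lemma hdeg_add: "hdeg w (\<alpha> + \<beta>) = hdeg w \<alpha> + hdeg w \<beta>"
  by (simp add: hdeg_def lookup_add distrib_left sum.distrib)

lemma hdeg_0 [simp]: "hdeg w 0 = 0"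
  by (simp add: hdeg_def)

lemma hdeg_single: "hdeg w (single a (Suc 0)) = hweight w a"
proof (cases a)
  case (Some i)
  have "(\<Sum>j\<in>UNIV. w j * lookup (single a (Suc 0)) (Some j)) =
      (\<Sum>j\<in>UNIV. if i = j then w j else 0)"
    by (rule sum.cong) (simp_all add: Some lookup_single when_def)
  then have "hdeg w (single a (Suc 0)) = (\<Sum>j\<in>UNIV. if i = j then w j else 0)"
    by (simp add: hdeg_def Some lookup_single)
  then show ?thesis by (simp add: Some)
qed (simp add: hdeg_def lookup_single)

lemma hdeg_expo: "hdeg w (expo u) = wdeg (hweight w) u"
  by (induction u) (simp_all add: hdeg_add hdeg_single)

lemma wdeg_std_word: "wdeg (hweight w) (std_word \<alpha>) = hdeg w \<alpha>"
  using hdeg_expo[of w "std_word \<alpha>"] by simp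

abbreviation "dexpo \<equiv> Poly_Mapping.map_key Some"

lemma lookup_dexpo: "lookup (dexpo \<alpha>) i = lookup \<alpha> (Some i)"
  by (simp add: map_key.rep_eq)

lemma dexpo_add: "dexpo (\<alpha> + \<beta>) = dexpo \<alpha> + dexpo \<beta>"
  by (rule poly_mapping_eqI) (simp add: lookup_dexpo lookup_add)

lemma dexpo_expo: "dexpo (expo m) = expo (strip m)"
proof (induction m)
  case (Cons a m)
  have "dexpo (single a 1) = (case a of None \<Rightarrow> 0 | Some i \<Rightarrow> single i (1::nat))"
    by (rule poly_mapping_eqI) (auto simp: lookup_dexpo lookup_single when_def split: option.split)
  with Cons show ?case by (cases a) (simp_all add: dexpo_add)
qed simp

lemma hom_order_iff: "hom_order w lt (\<gamma>, e) (\<gamma>', e') \<longleftrightarrow>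
    hdeg w \<gamma> < hdeg w \<gamma>' \<or> hdeg w \<gamma> = hdeg w \<gamma>' \<and> lt (dexpo \<gamma>, e) (dexpo \<gamma>', e')"
  by (simp add: hom_order_def hdeg_def Let_def)

text \<open>
  Within one degree the power of \<open>h\<close> is determined by the other exponents; this makes the homogenized
  ordering total.
\<close>

lemma hdeg_dexpo_inj:
  assumes "hdeg w \<alpha> = hdeg w \<beta>" "dexpo \<alpha> = dexpo \<beta>"
  shows "\<alpha> = \<beta>"
proof (rule poly_mapping_eqI)
  have Some: "lookup \<alpha> (Some i) = lookup \<beta> (Some i)" for i
    using assms(2) by (metis lookup_dexpo)
  then have "lookup \<alpha> None = lookup \<beta> None"
    using assms(1) by (simp add: hdeg_def)
  then show "lookup \<alpha> a = lookup \<beta> a" for a using Some by (cases a) simp_all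
qed

lemma module_monomial_order_hom_order:
  fixes lt :: "'v::{finite,linorder} expo \<times> 'e \<Rightarrow> 'v expo \<times> 'e \<Rightarrow> bool"
  assumes "module_monomial_order E lt"
  shows "module_monomial_order E (hom_order w lt)"
proof -
  have irr: "\<not> lt (\<alpha>, e) (\<alpha>, e)" if "e \<in> E" for \<alpha> e
    using assms that by (auto simp: module_monomial_order_def irreflp_on_def)
  have trans: "lt (\<alpha>, e) (\<alpha>'', e'')"
    if "lt (\<alpha>, e) (\<alpha>', e')" "lt (\<alpha>', e') (\<alpha>'', e'')" "e \<in> E" "e' \<in> E" "e'' \<in> E"
    for \<alpha> \<alpha>' \<alpha>'' e e' e''
    using assms that transp_onD[of "UNIV \<times> E" lt "(\<alpha>, e)" "(\<alpha>', e')" "(\<alpha>'', e'')"]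
    by (simp add: module_monomial_order_def)
  have total: "(\<alpha>, e) = (\<alpha>', e') \<or> lt (\<alpha>, e) (\<alpha>', e') \<or> lt (\<alpha>', e') (\<alpha>, e)"
    if "e \<in> E" "e' \<in> E" for \<alpha> \<alpha>' e e'
    using assms that totalp_onD[of "UNIV \<times> E" lt "(\<alpha>, e)" "(\<alpha>', e')"]
    by (auto simp: module_monomial_order_def)
  have add: "lt (\<alpha> + \<gamma>, e) (\<alpha>' + \<gamma>, e')" if "lt (\<alpha>, e) (\<alpha>', e')" "e \<in> E" "e' \<in> E"
    for \<alpha> \<alpha>' \<gamma> e e'
    using assms that by (simp add: module_monomial_order_def)
  show ?thesis
    unfolding module_monomial_order_def
  proof (intro conjI allI ballI impI)
    show "irreflp_on (UNIV \<times> E) (hom_order w lt)"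
      by (rule irreflp_onI) (auto simp: hom_order_iff irr)
    show "transp_on (UNIV \<times> E) (hom_order w lt)"
      by (rule transp_onI) (auto simp: hom_order_iff intro: trans)
    show "totalp_on (UNIV \<times> E) (hom_order w lt)"
    proof (rule totalp_onI)
      fix x y :: "'v option expo \<times> 'e" assume "x \<in> UNIV \<times> E" "y \<in> UNIV \<times> E" "x \<noteq> y"
      moreover obtain \<alpha> e \<beta> e' where "x = (\<alpha>, e)" "y = (\<beta>, e')" by (cases x; cases y)
      ultimately show "hom_order w lt x y \<or> hom_order w lt y x"
        using total[of e e' "dexpo \<alpha>" "dexpo \<beta>"] hdeg_dexpo_inj[of w \<alpha> \<beta>]
        by (auto simp: hom_order_iff)
    qed
    show "hom_order w lt (\<alpha> + \<gamma>, e) (\<alpha>' + \<gamma>, e')"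
      if "e \<in> E" "e' \<in> E" "hom_order w lt (\<alpha>, e) (\<alpha>', e')" for \<alpha> \<alpha>' \<gamma> e e'
      using that by (auto simp: hom_order_iff hdeg_add dexpo_add add)
  qed
qed

lemma lookup_le_hdeg:
  assumes "\<And>i. w i > 0"
  shows "lookup \<alpha> a \<le> hdeg w \<alpha>"
proof (cases a)
  case (Some i)
  have "lookup \<alpha> (Some i) \<le> w i * lookup \<alpha> (Some i)" using assms[of i] by simp
  also have "\<dots> \<le> (\<Sum>i\<in>UNIV. w i * lookup \<alpha> (Some i))"
    by (rule member_le_sum) simp_all
  finally show ?thesis by (simp add: Some hdeg_def)
qed (simp add: hdeg_def)

text \<open>With positive weights there are only finitely many exponents below a given one.\<close>

lemma wf_hom_order:
  assumes w: "\<And>i. w i > 0" and mmo: "module_monomial_order E lt" and e: "e \<in> E"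
  shows "wf {(\<alpha>, \<beta>). comp_order (hom_order w lt) e \<alpha> \<beta>}"
proof -
  let ?lt = "comp_order (hom_order w lt) e"
  note mo = monomial_order_comp[OF module_monomial_order_hom_order[OF mmo] e]
  have fin: "finite {\<alpha>. ?lt \<alpha> \<beta>}" for \<beta>
  proof -
    let ?F = "{f :: 'a option \<Rightarrow> nat. \<forall>a. f a \<in> {..hdeg w \<beta>}}"
    have "?F = PiE UNIV (\<lambda>_. {..hdeg w \<beta>})" by auto
    then have "finite ?F" by (simp add: finite_PiE)
    moreover have "lookup \<alpha> a \<le> hdeg w \<beta>" if "?lt \<alpha> \<beta>" for \<alpha> a
      using lookup_le_hdeg[of w \<alpha> a] w that by (auto simp: comp_order_def hom_order_iff)
    then have "lookup ` {\<alpha>. ?lt \<alpha> \<beta>} \<subseteq> ?F" by auto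
    ultimately have "finite (lookup ` {\<alpha>. ?lt \<alpha> \<beta>})" by (rule finite_subset[rotated])
    then show ?thesis by (rule finite_imageD) (simp add: inj_on_def)
  qed
  have "{\<gamma>. ?lt \<gamma> \<alpha>} \<subset> {\<gamma>. ?lt \<gamma> \<beta>}" if "?lt \<alpha> \<beta>" for \<alpha> \<beta>
  proof -
    have "?lt \<gamma> \<beta>" if "?lt \<gamma> \<alpha>" for \<gamma>
      using that \<open>?lt \<alpha> \<beta>\<close> by (rule transpD[OF monomial_orderD(1)[OF mo]])
    moreover have "\<not> ?lt \<alpha> \<alpha>" using monomial_orderD(2)[OF mo] by (simp add: irreflp_def)
    ultimately show ?thesis using that by blast
  qed
  then have "card {\<gamma>. ?lt \<gamma> \<alpha>} < card {\<gamma>. ?lt \<gamma> \<beta>}" if "?lt \<alpha> \<beta>" for \<alpha> \<beta>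
    using that psubset_card_mono[OF fin] by blast
  then have "{(\<alpha>, \<beta>). ?lt \<alpha> \<beta>} \<subseteq> Wellfounded.measure (\<lambda>\<beta>. card {\<alpha>. ?lt \<alpha> \<beta>})"
    by auto
  then show ?thesis by (rule wf_subset[OF wf_measure])
qed

lemma well_order_cond_hom_order:
  assumes w: "\<And>i. w i > 0"
  shows "well_order_cond (comp_order (hom_order w lt) e)"
  unfolding well_order_cond_def
proof
  fix \<alpha> :: "'a option expo"
  have "\<alpha> = 0" if "hdeg w \<alpha> = 0"
    using lookup_le_hdeg[of w \<alpha>] w that by (intro poly_mapping_eqI) simp
  then show "\<alpha> = 0 \<or> comp_order (hom_order w lt) e 0 \<alpha>"
    by (auto simp: comp_order_def hom_order_iff)
qed

section \<open>The relations of the homogenized algebra\<close>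

text \<open>
  As \<open>h\<close> comes first in the order of the variables, the relation \<open>x\<^sub>i h - h x\<^sub>i\<close> has the form required
  in a commutation system, with coefficient \<open>1\<close> and tail \<open>0\<close>.
\<close>

definition hom_coeff :: "('v \<Rightarrow> 'v \<Rightarrow> 'k::field) \<Rightarrow> 'v option \<Rightarrow> 'v option \<Rightarrow> 'k" where
  "hom_coeff c a b = (case (a, b) of (Some i, Some j) \<Rightarrow> c i j | _ \<Rightarrow> 1)"

definition hom_tail :: "('v \<Rightarrow> 'v \<Rightarrow> ('v, 'k::field) ncpoly) \<Rightarrow> ('v \<Rightarrow> nat) \<Rightarrow>
    'v option \<Rightarrow> 'v option \<Rightarrow> ('v option, 'k) ncpoly" where
  "hom_tail d w a b =
    (case (a, b) of (Some i, Some j) \<Rightarrow> homog_to w (w i + w j) (d i j) | _ \<Rightarrow> 0)"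

lemma hom_coeff_tail_simps [simp]:
  "hom_coeff c (Some i) (Some j) = c i j" "hom_coeff c None b = 1"
  "hom_tail d w (Some i) (Some j) = homog_to w (w i + w j) (d i j)" "hom_tail d w None b = 0"
  by (simp_all add: hom_coeff_def hom_tail_def)

text \<open>
  The word \<open>x\<^sub>j x\<^sub>i\<close> is not standard, so it is not cancelled by the tail, and the weight vector
  condition makes its weight maximal. Hence powers of \<open>h\<close> are inserted in the tail only.
\<close>

lemma homog_relation:
  assumes "weight_vector w d" "d i j \<in> std_polys" "i < j"
  shows "homog w (word [j, i] - scal (c i j) * word [i, j] - d i j) =
    word [Some j, Some i] - scal (c i j) * word [Some i, Some j] - homog_to w (w i + w j) (d i j)"
proof -
  let ?r = "word [j, i] - scal (c i j) * word [i, j] - d i j"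
  have d: "wdeg w m \<le> w i + w j" if "m \<in> keys (d i j)" for m
    using assms(1,3) that by (force simp: weight_vector_def pdeg_le_iff)
  have "keys ?r \<subseteq> {[j, i], [i, j]} \<union> keys (d i j)"
    using keys_diff_subset[of "word [j, i] - scal (c i j) * word [i, j]" "d i j"]
      keys_diff_subset[of "word [j, i]" "scal (c i j) * word [i, j]"]
      keys_scal_mult[of "c i j" "word [i, j]"] by auto
  then have upper: "pdeg w ?r \<le> w i + w j" using d by (force simp: pdeg_le_iff)
  have "[j, i] \<notin> keys (d i j)" using assms by (auto simp: std_polys_iff)
  then have "lookup (d i j) [j, i] = 0" by (simp add: in_keys_iff)
  moreover have "[i, j] \<noteq> [j, i]" using assms(3) by auto
  ultimately have "lookup ?r [j, i] = 1"
    by (simp only: lookup_minus lookup_scal_mult lookup_word if_False) simp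
  then have "[j, i] \<in> keys ?r" by (simp add: in_keys_iff)
  then have "w i + w j \<le> pdeg w ?r" using wdeg_le_pdeg[of "[j, i]" ?r w] by simp
  with upper have "pdeg w ?r = w i + w j" by simp
  then show ?thesis by (simp add: homog_def homog_to_simps lift_def)
qed

lemma relations_hom:
  assumes "weight_vector w d" "\<And>i j. i < j \<Longrightarrow> d i j \<in> std_polys"
  shows "relations (hom_coeff c) (hom_tail d w) = hom_relations c d w"
proof (intro equalityI subsetI)
  fix r assume "r \<in> relations (hom_coeff c) (hom_tail d w)"
  then obtain a b where ab: "a < b"
    "r = word [b, a] - scal (hom_coeff c a b) * word [a, b] - hom_tail d w a b"
    by (auto simp: relations_def)
  then obtain j where j: "b = Some j" by (cases b) auto
  show "r \<in> hom_relations c d w"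
  proof (cases a)
    case None
    then show ?thesis using ab j by (auto simp: hom_relations_def)
  next
    case (Some i)
    then have "i < j" using ab j by simp
    moreover have "r = homog w (word [j, i] - scal (c i j) * word [i, j] - d i j)"
      using ab j Some \<open>i < j\<close> by (simp add: homog_relation[OF assms])
    ultimately show ?thesis unfolding hom_relations_def relations_def by blast
  qed
next
  fix r assume "r \<in> hom_relations c d w"
  then consider (h) i where "r = word [Some i, None] - word [None, Some i]"
    | (x) i j where "i < j" "r = homog w (word [j, i] - scal (c i j) * word [i, j] - d i j)"
    by (auto simp: hom_relations_def relations_def)
  then show "r \<in> relations (hom_coeff c) (hom_tail d w)"
  proof cases
    case h
    then have "r = word [Some i, None] - scal (hom_coeff c None (Some i)) *
        word [None, Some i] - hom_tail d w None (Some i)" by simp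
    moreover have "None < Some i" by simp
    ultimately show ?thesis unfolding relations_def by blast
  next
    case x
    then have "r = word [Some j, Some i] - scal (hom_coeff c (Some i) (Some j)) *
        word [Some i, Some j] - hom_tail d w (Some i) (Some j)"
      by (simp add: homog_relation[OF assms])
    moreover have "Some i < Some j" using x by simp
    ultimately show ?thesis unfolding relations_def by blast
  qed
qed

lemma hom_relations_subset: "hom_relations c d w \<subseteq> hom_ideal c d I w"
proof -
  have "relations c d \<subseteq> PBW_ideal c d I"
    unfolding PBW_ideal_def using Idl_superset by blast
  then have "homog w ` relations c d \<subseteq> hom_ideal c d I w"
    using hom_ideal_generators(1) by blast
  moreover have "word [Some i, None] - word [None, Some i] \<in> hom_ideal c d I w" for i
    using ideal_uminus[OF ideal_hom_ideal hom_ideal_generators(2)[of i c d I w]] by simp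
  ultimately show ?thesis by (auto simp: hom_relations_def)
qed

text \<open>
  The tails of the homogenized relations have the same degree as the product that they belong to,
  so that they are compared by the given ordering.
\<close>

lemma reduction_system_hom:
  assumes w: "\<And>i. w i > 0" and wv: "weight_vector w d"
    and ord: "ordering_on_module c d E lt" and e: "e \<in> E"
  shows "reduction_system (hom_coeff c) (hom_tail d w) (comp_order (hom_order w lt) e)"
proof
  have mmo: "module_monomial_order E lt" and cs: "commutation_system c d (comp_order lt e)"
    using ord e by (auto simp: ordering_on_module_def)
  note mo = monomial_order_comp[OF mmo e]
  show "monomial_order (comp_order (hom_order w lt) e)"
    by (rule monomial_order_comp[OF module_monomial_order_hom_order[OF mmo] e])
  show "wf {(\<alpha>, \<beta>). comp_order (hom_order w lt) e \<alpha> \<beta>}"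
    by (rule wf_hom_order[OF w mmo e])
  show "hom_coeff c a b \<noteq> 0" if "a < b" for a b
    using that cs by (cases a; cases b) (auto simp: commutation_system_def)
  show "comp_order (hom_order w lt) e (expo u) (single a 1 + single b 1)"
    if ab: "a < b" and u: "u \<in> keys (hom_tail d w a b)" for a b u
  proof -
    obtain i j where ij: "a = Some i" "b = Some j" "i < j"
      using ab u by (cases a; cases b) auto
    have d: "d i j \<in> std_polys"
      and lt: "\<And>\<alpha>. lexp (comp_order lt e) (d i j) = Some \<alpha> \<Longrightarrow>
        comp_order lt e \<alpha> (single i 1 + single j 1)"
      using cs ij(3) by (auto simp: commutation_system_def)
    obtain m where m: "m \<in> keys (d i j)" "u = lift w (w i + w j) m"
      using u keys_homog_to[of w "w i + w j" "d i j"] by (auto simp: ij)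
    then have supp: "expo m \<in> supp (d i j)" using d by (simp add: expo_mem_supp)
    then obtain \<alpha> where \<alpha>: "lexp (comp_order lt e) (d i j) = Some \<alpha>"
      by (cases "lexp (comp_order lt e) (d i j)") (auto simp: lexp_eq_None)
    then have "expo m = \<alpha> \<or> comp_order lt e (expo m) \<alpha>"
      using supp by (simp add: lexp_eq_Some[OF mo])
    then have "comp_order lt e (expo m) (single i 1 + single j 1)"
      using lt[OF \<alpha>] transpD[OF monomial_orderD(1)[OF mo]] by metis
    moreover have "dexpo (expo u) = expo m" by (simp add: dexpo_expo m)
    moreover have "hdeg w (expo u) = w i + w j"
    proof -
      have "wdeg w m \<le> w i + w j"
        using wv m(1) ij(3) by (force simp: weight_vector_def pdeg_le_iff)
      then show ?thesis by (simp add: hdeg_expo m(2) wdeg_lift)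
    qed
    moreover have "hdeg w (single a 1 + single b 1) = w i + w j"
      by (simp add: hdeg_add hdeg_single ij)
    moreover have "dexpo (single a 1 + single b 1) = single i 1 + single j (1 :: nat)"
      using dexpo_expo[of "[Some i, Some j]"] by (simp add: ij dexpo_add)
    ultimately show ?thesis by (simp add: comp_order_def hom_order_iff del: One_nat_def)
  qed
qed

lemma std_hom_tail: "(\<And>i j. i < j \<Longrightarrow> d i j \<in> std_polys) \<Longrightarrow> a < b \<Longrightarrow> hom_tail d w a b \<in> std_polys"
  by (cases a; cases b) (auto intro: std_homog_to)

lemma reduction_ideal_hom:
  assumes "\<And>i. w i > 0" "weight_vector w d" "ordering_on_module c d E lt" "e \<in> E"
    and "ideal K free_alg" "hom_relations c d w \<subseteq> K"
  shows "reduction_ideal (hom_coeff c) (hom_tail d w) (comp_order (hom_order w lt) e) K"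
proof -
  have d: "d i j \<in> std_polys" if "i < j" for i j
    using assms(3,4) that by (auto simp: ordering_on_module_def commutation_system_def)
  show ?thesis
    using assms(5,6) relations_hom[OF assms(2) d, of c]
    by (intro reduction_ideal.intro reduction_ideal_axioms.intro
        reduction_system_hom[OF assms(1-4)]) simp_all
qed

lemma (in reduction_system) commutation_systemI:
  assumes "\<And>i j. i < j \<Longrightarrow> d i j \<in> std_polys"
  shows "commutation_system c d lt"
  unfolding commutation_system_def
proof (intro conjI allI impI)
  fix i j :: 'v assume ij: "i < j"
  show "c i j \<noteq> 0" by (rule c_nonzero[OF ij])
  show "d i j \<in> std_polys" by (rule assms[OF ij])
  show "lt \<alpha> (single i 1 + single j 1)" if "lexp lt (d i j) = Some \<alpha>" for \<alpha>
    using that d_less[OF ij, of "std_word \<alpha>"] by (simp add: lexp_eq_Some[OF mo] mem_supp)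
qed (use mo replacement_terminates in auto)

section \<open>PBW-reduction data of the homogenized algebra\<close>

text \<open>
  The leading exponents of a homogeneous ideal are those of its homogeneous elements, by Dickson's
  lemma finitely many of these suffice, and division with remainder shows that they generate
  the ideal modulo the relations.
\<close>

lemma hom_basis_exists:
  assumes w: "\<And>i. w i > 0" and wv: "weight_vector w d"
    and ord: "ordering_on_module c d E lt" and e: "e \<in> E"
  defines "lt' \<equiv> comp_order (hom_order w lt) e"
  shows "\<exists>B. (\<forall>p\<in>B. \<exists>k. homogeneous (hweight w) k p) \<and>
     (\<exists>c' d'. relations c' d' = hom_relations c d w \<and> PBW_datum c' d' B lt' \<and>
        PBW_ideal c' d' B = hom_ideal c d I w)"
proof -
  let ?c = "hom_coeff c" and ?d = "hom_tail d w" and ?J = "hom_ideal c d I w"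
  let ?T = "lexps lt' (?J \<inter> std_polys)"
  have d: "d i j \<in> std_polys" if "i < j" for i j
    using ord e that by (auto simp: ordering_on_module_def commutation_system_def)
  note J = ideal_hom_ideal[of c d I w]
  have rel: "relations ?c ?d = hom_relations c d w" by (rule relations_hom[OF wv d])
  interpret reduction_system ?c ?d lt'
    unfolding lt'_def by (rule reduction_system_hom[OF w wv ord e])
  interpret J: reduction_ideal ?c ?d lt' ?J
    unfolding lt'_def by (rule reduction_ideal_hom[OF w wv ord e J hom_relations_subset])
  have "\<exists>f\<in>?J \<inter> std_polys. homogeneous (hweight w) (hdeg w \<alpha>) f \<and> lexp lt' f = Some \<alpha>"
    if "\<alpha> \<in> ?T" for \<alpha>
  proof -
    obtain f where f: "f \<in> ?J" "f \<in> std_polys" "lexp lt' f = Some \<alpha>"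
      using \<open>\<alpha> \<in> ?T\<close> by (auto simp: lexps_def)
    let ?f = "hcomp (hweight w) (hdeg w \<alpha>) f"
    have "lexp lt' ?f = Some \<alpha>"
      using f(3) by (auto simp: lexp_eq_Some[OF mo] supp_hcomp wdeg_std_word)
    then show ?thesis
      using f by (intro bexI[of _ ?f] conjI homogeneous_hcomp)
        (simp_all add: std_hcomp hcomp_mem_hom_ideal)
  qed
  then obtain f where f: "\<And>\<alpha>. \<alpha> \<in> ?T \<Longrightarrow> f \<alpha> \<in> ?J \<inter> std_polys"
    "\<And>\<alpha>. \<alpha> \<in> ?T \<Longrightarrow> homogeneous (hweight w) (hdeg w \<alpha>) (f \<alpha>)"
    "\<And>\<alpha>. \<alpha> \<in> ?T \<Longrightarrow> lexp lt' (f \<alpha>) = Some \<alpha>"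
    by metis
  obtain F where F: "finite F" "F \<subseteq> ?T" "\<And>\<alpha>. \<alpha> \<in> ?T \<Longrightarrow> \<exists>\<beta>\<in>F. \<exists>\<gamma>. \<alpha> = \<beta> + \<gamma>"
    using dickson[of ?T] by metis
  let ?B = "f ` F"
  have lexps_B: "lexps lt' ?B = F"
    using f(3) F(2) by (force simp: lexps_def)
  have Lexps_B: "Lexps lt' ?B = ?T"
  proof
    show "Lexps lt' ?B \<subseteq> ?T"
      using F(2) J.lexps_add by (auto simp: Lexps_def lexps_B)
    show "?T \<subseteq> Lexps lt' ?B"
      using F(3) by (fastforce simp: Lexps_def lexps_B)
  qed
  let ?K = "PBW_ideal ?c ?d ?B"
  have K_sub: "?K \<subseteq> ?J"
    unfolding PBW_ideal_def using f(1) F(2) J.relations_subset by (intro Idl_minimal[OF J]) blast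
  have gen: "?B \<union> relations ?c ?d \<subseteq> ?K"
    unfolding PBW_ideal_def by (rule Idl_superset)
  interpret K: reduction_ideal ?c ?d lt' ?K
    using gen unfolding lt'_def rel
    by (intro reduction_ideal_hom[OF w wv ord e ideal_PBW_ideal]) blast
  have T_sub: "?T \<subseteq> lexps lt' (?K \<inter> std_polys)"
  proof -
    have "?B \<subseteq> ?K \<inter> std_polys" using gen f(1) F(2) by blast
    then have "F \<subseteq> lexps lt' (?K \<inter> std_polys)"
      using lexps_B unfolding lexps_def by blast
    then show ?thesis using F(3) K.lexps_add by blast
  qed
  have "?J \<subseteq> ?K"
  proof
    fix p assume p: "p \<in> ?J"
    obtain q where q: "q \<in> std_polys" "p - q \<in> ?K" using K.standard_form .
    obtain r where r: "r \<in> std_polys" "q - r \<in> ?K" "supp r \<inter> lexps lt' (?K \<inter> std_polys) = {}"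
      using reduced_form_exists[OF mo wf_lt ideal_PBW_ideal q(1)] by blast
    have sum: "(p - q) + (q - r) \<in> ?K" using q(2) r(2) by (rule ideal_add[OF ideal_PBW_ideal])
    then have "p - r \<in> ?J" using K_sub by auto
    then have "p - (p - r) \<in> ?J" by (rule ideal_diff[OF J p])
    then have "r = 0"
      using r T_sub by (intro std_mem_ideal_eq_0[OF mo, of r ?J]) auto
    then show "p \<in> ?K" using sum by simp
  qed
  then have K: "?K = ?J" using K_sub by blast
  have "PBW_datum ?c ?d ?B lt'"
    unfolding PBW_datum_def K
  proof (intro conjI)
    show "commutation_system ?c ?d lt'" by (intro commutation_systemI std_hom_tail d)
    show "well_order_cond lt'" unfolding lt'_def by (rule well_order_cond_hom_order[OF w])
    show "?B \<subseteq> std_polys" using f(1) F(2) by blast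
  qed (use F(1) Lexps_B in auto)
  moreover have "\<forall>p\<in>?B. \<exists>k. homogeneous (hweight w) k p" using f(2) F(2) by blast
  ultimately show ?thesis using rel K by blast
qed

section \<open>Normal forms in the homogenized algebra\<close>

locale homogenized_algebra =
  fixes c :: "'v::{finite,linorder} \<Rightarrow> 'v \<Rightarrow> 'k::field"
    and d :: "'v \<Rightarrow> 'v \<Rightarrow> ('v, 'k) ncpoly"
    and I :: "('v, 'k) ncpoly set"
    and w :: "'v \<Rightarrow> nat"
    and E :: "'e set"
    and lt :: "'v expo \<times> 'e \<Rightarrow> 'v expo \<times> 'e \<Rightarrow> bool"
  assumes w_pos: "\<And>i. w i > 0"
    and weight: "weight_vector w d"
    and finite_E: "finite E"
    and ordering: "ordering_on_module c d E lt"
begin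

abbreviation "J \<equiv> PBW_ideal c d I"
abbreviation "Jw \<equiv> hom_ideal c d I w"
abbreviation "ltw \<equiv> hom_order w lt"
abbreviation "Iw \<equiv> hom_basis c d I w lt"
abbreviation "hnf \<equiv> nf Jw Iw ltw"

lemma mmo: "module_monomial_order E lt"
  using ordering by (simp add: ordering_on_module_def)

lemma mmow: "module_monomial_order E ltw"
  by (rule module_monomial_order_hom_order[OF mmo])

lemma mow: "e \<in> E \<Longrightarrow> monomial_order (comp_order ltw e)"
  by (rule monomial_order_comp[OF mmow])

lemma Lexps_hom_basis:
  assumes "e \<in> E"
  shows "Lexps (comp_order ltw e) (Iw e) = lexps (comp_order ltw e) (Jw \<inter> std_polys)"
proof -
  obtain c' d' where "PBW_datum c' d' (Iw e) (comp_order ltw e)" "PBW_ideal c' d' (Iw e) = Jw"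
    using someI_ex[OF hom_basis_exists[OF w_pos weight ordering assms, of I]]
    unfolding hom_basis_def by blast
  then show ?thesis by (simp add: PBW_datum_def)
qed

text \<open>
  Two reduced representatives differ by an element of the ideal whose leading exponent, if there is
  one, would be reducible.
\<close>

lemma nf_unique:
  assumes e: "e \<in> E" and p: "p \<in> std_polys" "supp p \<inter> Lexps (comp_order ltw e) (Iw e) = {}"
    and q: "q \<in> std_polys" "supp q \<inter> Lexps (comp_order ltw e) (Iw e) = {}"
    and "p - q \<in> Jw"
  shows "p = q"
proof -
  have "p - q = 0"
  proof (rule std_mem_ideal_eq_0[OF mow[OF e]])
    show "supp (p - q) \<inter> lexps (comp_order ltw e) (Jw \<inter> std_polys) = {}"
      using supp_diff[of p q] p(2) q(2) unfolding Lexps_hom_basis[OF e] by blast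
  qed (use assms std_diff in auto)
  then show ?thesis by simp
qed

lemma nf_eqI:
  assumes "e \<in> E" "p \<in> std_polys" "supp p \<inter> Lexps (comp_order ltw e) (Iw e) = {}"
  shows "hnf e (coset Jw p) = p"
  unfolding nf_def
proof (rule the_equality)
  fix q assume q: "q \<in> std_polys \<and> coset Jw q = coset Jw p \<and>
    (\<forall>\<alpha>\<in>supp q. \<alpha> \<notin> Lexps (comp_order ltw e) (Iw e))"
  then have "q - p \<in> Jw" by (simp add: coset_eq_iff[OF ideal_hom_ideal])
  then show "q = p"
    using q assms by (intro nf_unique) auto
qed (use assms in auto)

lemma nf_coset:
  assumes e: "e \<in> E"
  shows "hnf e (coset Jw p) \<in> std_polys" "p - hnf e (coset Jw p) \<in> Jw"
    "supp (hnf e (coset Jw p)) \<inter> Lexps (comp_order ltw e) (Iw e) = {}"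
proof -
  note J = ideal_hom_ideal[of c d I w]
  interpret reduction_ideal "hom_coeff c" "hom_tail d w" "comp_order ltw e" Jw
    by (rule reduction_ideal_hom[OF w_pos weight ordering e J hom_relations_subset])
  obtain q where q: "q \<in> std_polys" "p - q \<in> Jw" using standard_form .
  obtain r where r: "r \<in> std_polys" "q - r \<in> Jw"
    "supp r \<inter> Lexps (comp_order ltw e) (Iw e) = {}"
    using reduced_form_exists[OF mo wf_lt J q(1)] unfolding Lexps_hom_basis[OF e] by blast
  have pr: "p - r \<in> Jw" using ideal_add[OF J q(2) r(2)] by simp
  then have "hnf e (coset Jw p) = r"
    using nf_eqI[OF e r(1,3)] by (simp flip: coset_eq_iff[OF J])
  then show "hnf e (coset Jw p) \<in> std_polys" "p - hnf e (coset Jw p) \<in> Jw"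
    "supp (hnf e (coset Jw p)) \<inter> Lexps (comp_order ltw e) (Iw e) = {}"
    using r pr by simp_all
qed

text \<open>The ideal being homogeneous, so are the normal forms of homogeneous elements.\<close>

lemma homogeneous_nf:
  assumes e: "e \<in> E" and p: "homogeneous (hweight w) k p"
  shows "homogeneous (hweight w) k (hnf e (coset Jw p))"
proof -
  let ?q = "hnf e (coset Jw p)"
  note q = nf_coset[OF e, of p]
  let ?r = "hcomp (hweight w) k ?q"
  have pr: "p - ?r \<in> Jw"
    using hcomp_mem_hom_ideal[OF q(2), of k] hcomp_homogeneous[OF p, of k]
    by (simp add: hcomp_diff)
  have "?q = ?r"
  proof (rule nf_unique[OF e q(1,3)])
    show "?r \<in> std_polys" by (rule std_hcomp[OF q(1)])
    show "supp ?r \<inter> Lexps (comp_order ltw e) (Iw e) = {}"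
      using q(3) by (auto simp: supp_hcomp)
    show "?q - ?r \<in> Jw" using ideal_diff[OF ideal_hom_ideal pr q(2)] by simp
  qed
  then show ?thesis by (metis homogeneous_hcomp)
qed

text \<open>
  Passing to the normal form does not introduce larger monomials: otherwise the leading monomial of
  the normal form would be the one of an element of the ideal.
\<close>

lemma nf_dominated:
  assumes e: "e \<in> E" and p: "p \<in> std_polys" and \<alpha>: "\<alpha> \<in> supp (hnf e (coset Jw p))"
  shows "\<exists>\<beta>\<in>supp p. \<alpha> = \<beta> \<or> comp_order ltw e \<alpha> \<beta>"
proof (rule ccontr)
  assume neg: "\<not> ?thesis"
  let ?lt = "comp_order ltw e" and ?q = "hnf e (coset Jw p)"
  note mo = mow[OF e] and q = nf_coset[OF e, of p]
  have trans: "?lt x z" if "?lt x y" "?lt y z" for x y z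
    using monomial_orderD(1)[OF mo] that by (rule transpD)
  have small: "?lt \<beta> \<alpha>" if "\<beta> \<in> supp p" for \<beta>
    using neg that totalpD[OF monomial_orderD(3)[OF mo], of \<alpha> \<beta>] by blast
  obtain \<gamma> where "lexp ?lt ?q = Some \<gamma>" using \<alpha> by (cases "lexp ?lt ?q") (auto simp: lexp_eq_None)
  then have \<gamma>: "\<gamma> \<in> supp ?q" "\<And>\<beta>. \<beta> \<in> supp ?q \<Longrightarrow> \<beta> = \<gamma> \<or> ?lt \<beta> \<gamma>"
    by (simp_all add: lexp_eq_Some[OF mo])
  have small': "?lt \<beta> \<gamma>" if "\<beta> \<in> supp p" for \<beta>
    using small[OF that] \<gamma>(2)[OF \<alpha>] trans by blast
  have "\<not> ?lt \<gamma> \<gamma>" using monomial_orderD(2)[OF mo] by (simp add: irreflp_def)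
  then have "\<gamma> \<notin> supp p" using small' by blast
  then have "\<gamma> \<in> supp (p - ?q)" using \<gamma>(1) by (simp add: supp_def lookup_minus)
  moreover have "\<beta> = \<gamma> \<or> ?lt \<beta> \<gamma>" if "\<beta> \<in> supp (p - ?q)" for \<beta>
    using that supp_diff[of p ?q] small' \<gamma>(2) by blast
  ultimately have "lexp ?lt (p - ?q) = Some \<gamma>" by (simp add: lexp_eq_Some[OF mo])
  then have "\<gamma> \<in> Lexps ?lt (Iw e)"
    unfolding Lexps_hom_basis[OF e] lexps_def using q(1,2) std_diff[OF p q(1)] by blast
  then show False using \<gamma>(1) q(3) by blast
qed

end

section \<open>Spans under homogenization\<close>

lemma wdeg_le_mdeg: "finite E \<Longrightarrow> e \<in> E \<Longrightarrow> m \<in> keys (t e) \<Longrightarrow> wdeg w m \<le> mdeg w E t"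
  unfolding mdeg_def by (rule Max_ge) auto

lemma supp_sum: "supp (\<Sum>x\<in>X. f x) \<subseteq> (\<Union>x\<in>X. supp (f x))"
proof (induction X rule: infinite_finite_induct)
  case (insert x X)
  then show ?case using supp_add[of "f x" "\<Sum>x\<in>X. f x"] by auto
qed simp_all

lemma supp_dehom:
  assumes "p \<in> std_polys"
  shows "supp (dehom p) \<subseteq> dexpo ` supp p"
proof
  fix \<alpha> assume "\<alpha> \<in> supp (dehom p)"
  then obtain m where m: "m \<in> keys p" "std_word \<alpha> = strip m"
    using keys_dehom[of p] by (auto simp: mem_supp)
  then have "\<alpha> = dexpo (expo m)" by (metis dexpo_expo expo_std_word)
  then show "\<alpha> \<in> dexpo ` supp p" using expo_mem_supp[OF assms m(1)] by blast
qed

lemma supp_homog_to: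
  assumes "p \<in> std_polys" "\<alpha> \<in> supp (homog_to w D p)"
  shows "dexpo \<alpha> \<in> supp p"
proof -
  obtain m where m: "m \<in> keys p" "std_word \<alpha> = lift w D m"
    using assms(2) keys_homog_to[of w D p] by (auto simp: mem_supp)
  then have "dexpo \<alpha> = expo m" by (metis dexpo_expo expo_std_word strip_simps(7))
  then show ?thesis using expo_mem_supp[OF assms(1) m(1)] by simp
qed

lemma hdeg_supp: "homogeneous (hweight w) k p \<Longrightarrow> \<alpha> \<in> supp p \<Longrightarrow> hdeg w \<alpha> = k"
  by (metis homogeneous_def mem_supp wdeg_std_word)

context homogenized_algebra
begin

lemma homogeneous_cong:
  assumes "homogeneous (hweight w) k p" "homogeneous (hweight w) k q" "dehom p - dehom q \<in> J"
  shows "p - q \<in> Jw"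
  using assms by (intro homogeneous_mem_hom_idealI[OF homogeneous_diff]) simp_all

lemma dehom_rep_span:
  assumes "t \<in> rep_span two Jw E (homog_vec w E ` X)"
  shows "(\<lambda>e. dehom (t e)) \<in> rep_span two J E X"
  using assms
proof (induction rule: rep_span.induct)
  case (base t)
  then obtain x where x: "x \<in> X" "t = homog_vec w E x" by blast
  show ?case
    by (rule rep_span.cong[OF rep_span.base[OF x(1)]])
      (simp add: x(2) homog_vec_def ideal_0[OF ideal_PBW_ideal])
next
  case (cong x y)
  show ?case
    by (rule rep_span.cong[OF cong.IH])
      (use cong.hyps(2) dehom_mem_PBW_ideal in \<open>force simp flip: dehom_simps(3)\<close>)
next
  case zero
  show ?case by (simp add: rep_span.zero)
next
  case (add x y)
  then show ?case by (simp add: rep_span.add)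
next
  case (left x p)
  then show ?case by (simp add: dehom_mult rep_span.left)
next
  case (right x p)
  then show ?case by (simp add: dehom_mult rep_span.right)
qed

text \<open>
  A relation in the original algebra survives homogenization once the degree is large enough to
  accommodate all its terms, that is after multiplication by a power of \<open>h\<close>.
\<close>

lemma homog_rep_span:
  assumes "t \<in> rep_span two J E X"
  shows "\<exists>D\<^sub>0. \<forall>D\<ge>D\<^sub>0. (\<lambda>e. homog_to w D (t e)) \<in> rep_span two Jw E (homog_vec w E ` X)"
    (is "\<exists>D\<^sub>0. \<forall>D\<ge>D\<^sub>0. _ \<in> ?N")
  using assms
proof (induction rule: rep_span.induct)
  case (base x)
  show ?case
  proof (intro exI allI impI)
    fix D assume D: "mdeg w E x \<le> D"
    let ?h = "word (replicate (D - mdeg w E x) None) :: ('v option, 'k) ncpoly"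
    have "(\<lambda>e. ?h * homog_vec w E x e) \<in> ?N"
      by (intro rep_span.left rep_span.base imageI base)
    then show "(\<lambda>e. homog_to w D (x e)) \<in> ?N"
    proof (rule rep_span.cong)
      fix e assume e: "e \<in> E"
      have le: "wdeg w m \<le> mdeg w E x" if "m \<in> keys (x e)" for m
        by (rule wdeg_le_mdeg[where t = x, OF finite_E e that])
      have "homogeneous (hweight w) (D - mdeg w E x) ?h" by (simp add: homogeneous_word)
      from homogeneous_mult[OF this homogeneous_homog_to[OF le]]
      have "homogeneous (hweight w) D (?h * homog_vec w E x e)"
        using D e by (simp add: homog_vec_def)
      moreover have "homogeneous (hweight w) D (homog_to w D (x e))"
        by (rule homogeneous_homog_to) (use le D in force)
      ultimately show "?h * homog_vec w E x e - homog_to w D (x e) \<in> Jw"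
        by (rule homogeneous_cong)
          (simp add: dehom_mult homog_vec_def e ideal_0[OF ideal_PBW_ideal])
    qed
  qed
next
  case (cong x y)
  then obtain D0 where D0: "\<And>D. D \<ge> D0 \<Longrightarrow> (\<lambda>e. homog_to w D (x e)) \<in> ?N" by blast
  let ?M = "mdeg w E (\<lambda>e. x e - y e)"
  show ?case
  proof (intro exI allI impI)
    fix D assume D: "max D0 ?M \<le> D"
    then have "(\<lambda>e. homog_to w D (x e)) \<in> ?N" by (intro D0) simp
    then show "(\<lambda>e. homog_to w D (y e)) \<in> ?N"
    proof (rule rep_span.cong)
      fix e assume e: "e \<in> E"
      have "homogeneous (hweight w) D (homog_to w D (x e - y e))"
        using wdeg_le_mdeg[OF finite_E e, of _ "\<lambda>e. x e - y e" w] D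
        by (intro homogeneous_homog_to) force
      then have "homog_to w D (x e - y e) \<in> Jw"
        using cong.hyps(2)[OF e] by (intro homogeneous_mem_hom_idealI) simp_all
      then show "homog_to w D (x e) - homog_to w D (y e) \<in> Jw"
        by (simp add: homog_to_simps)
    qed
  qed
next
  case zero
  show ?case by (simp add: homog_to_simps rep_span.zero)
next
  case (add x y)
  then obtain D1 D2 where "\<And>D. D \<ge> D1 \<Longrightarrow> (\<lambda>e. homog_to w D (x e)) \<in> ?N"
    "\<And>D. D \<ge> D2 \<Longrightarrow> (\<lambda>e. homog_to w D (y e)) \<in> ?N" by blast
  then show ?case
    by (intro exI[of _ "max D1 D2"]) (simp add: homog_to_simps rep_span.add)
next
  case (left x p)
  then obtain D0 where D0: "\<And>D. D \<ge> D0 \<Longrightarrow> (\<lambda>e. homog_to w D (x e)) \<in> ?N" by blast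
  show ?case
  proof (intro exI allI impI)
    fix D assume D: "pdeg w p + max D0 (mdeg w E x) \<le> D"
    then have "(\<lambda>e. homog w p * homog_to w (D - pdeg w p) (x e)) \<in> ?N"
      by (intro rep_span.left D0) simp
    then show "(\<lambda>e. homog_to w D (p * x e)) \<in> ?N"
    proof (rule rep_span.cong)
      fix e assume e: "e \<in> E"
      have le: "wdeg w m \<le> D - pdeg w p" if "m \<in> keys (x e)" for m
        using wdeg_le_mdeg[where w = w and t = x, OF finite_E e that] D by simp
      have "homogeneous (hweight w) D (homog w p * homog_to w (D - pdeg w p) (x e))"
        using homogeneous_mult[OF homogeneous_homog[of w p] homogeneous_homog_to[OF le]] D by simp
      moreover have "homogeneous (hweight w) D (homog_to w D (p * x e))"
      proof (rule homogeneous_homog_to)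
        fix m assume "m \<in> keys (p * x e)"
        then obtain u v where "u \<in> keys p" "v \<in> keys (x e)" "m = u @ v"
          using keys_mult[of p "x e"] by (auto simp: plus_list_def)
        then show "wdeg w m \<le> D"
          using wdeg_le_pdeg[of u p w] le[of v] D by simp
      qed
      ultimately show "homog w p * homog_to w (D - pdeg w p) (x e) - homog_to w D (p * x e) \<in> Jw"
        by (rule homogeneous_cong) (simp add: dehom_mult ideal_0[OF ideal_PBW_ideal])
    qed
  qed
next
  case (right x p)
  then obtain D0 where D0: "\<And>D. D \<ge> D0 \<Longrightarrow> (\<lambda>e. homog_to w D (x e)) \<in> ?N" by blast
  show ?case
  proof (intro exI allI impI)
    fix D assume D: "max D0 (mdeg w E x) + pdeg w p \<le> D"
    then have "(\<lambda>e. homog_to w (D - pdeg w p) (x e) * homog w p) \<in> ?N"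
      by (intro rep_span.right right.hyps(1) D0) simp
    then show "(\<lambda>e. homog_to w D (x e * p)) \<in> ?N"
    proof (rule rep_span.cong)
      fix e assume e: "e \<in> E"
      have le: "wdeg w m \<le> D - pdeg w p" if "m \<in> keys (x e)" for m
        using wdeg_le_mdeg[where w = w and t = x, OF finite_E e that] D by simp
      have "homogeneous (hweight w) D (homog_to w (D - pdeg w p) (x e) * homog w p)"
        using homogeneous_mult[OF homogeneous_homog_to[OF le] homogeneous_homog[of w p]] D by simp
      moreover have "homogeneous (hweight w) D (homog_to w D (x e * p))"
      proof (rule homogeneous_homog_to)
        fix m assume "m \<in> keys (x e * p)"
        then obtain u v where "u \<in> keys (x e)" "v \<in> keys p" "m = u @ v"
          using keys_mult[of "x e" p] by (auto simp: plus_list_def)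
        then show "wdeg w m \<le> D"
          using wdeg_le_pdeg[of v p w] le[of u] D by simp
      qed
      ultimately show "homog_to w (D - pdeg w p) (x e) * homog w p - homog_to w D (x e * p) \<in> Jw"
        by (rule homogeneous_cong) (simp add: dehom_mult ideal_0[OF ideal_PBW_ideal])
    qed
  qed
qed

section \<open>Dehomogenizing Groebner bases\<close>

abbreviation "htau \<equiv> tau Jw Iw ltw E"

lemma htau_coset_vec: "e \<in> E \<Longrightarrow> htau (coset_vec Jw E t) e = hnf e (coset Jw (t e))"
  by (simp add: tau_def coset_vec_def)

lemma coset_vec_htau: "coset_vec Jw E (htau (coset_vec Jw E t)) = coset_vec Jw E t"
  unfolding coset_vec_eq_iff[OF ideal_hom_ideal]
  using ideal_uminus[OF ideal_hom_ideal nf_coset(2)] by (fastforce simp: htau_coset_vec)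

lemma ltw_trans:
  assumes "x = y \<or> ltw x y" "y = z \<or> ltw y z" "snd x \<in> E" "snd y \<in> E" "snd z \<in> E"
  shows "x = z \<or> ltw x z"
proof -
  have "x \<in> UNIV \<times> E" "y \<in> UNIV \<times> E" "z \<in> UNIV \<times> E"
    using assms(3-5) by (cases x; cases y; cases z; simp)+
  then show ?thesis
    using mmow assms(1,2) transp_onD[of "UNIV \<times> E" ltw x y z]
    by (auto simp: module_monomial_order_def)
qed

text \<open>
  An element \<open>t\<close> of the original module is homogenized to a degree \<open>D\<close> in which it belongs to the
  homogenized module. Of a representation by the homogeneous basis \<open>G\<close> only the part of degree \<open>D\<close> is
  kept, and then \<open>h\<close> is set to \<open>1\<close>. Within degree \<open>D\<close> the homogenized ordering is the given one, so
  the bounds on the leading exponents carry over. Different elements of \<open>G\<close> may have the same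
  dehomogenization; their coefficients are added up.
\<close>

lemma dehom_induces_groebner_basis:
  assumes gb: "groebner_basis Jw Iw ltw E
      (span two (free_alg Quot Jw) E (coset_vec Jw E ` homog_vec w E ` X)) G"
    and hom: "\<And>g. g \<in> G \<Longrightarrow> homogeneous_vec (hweight w) Jw E g"
  shows "induces_groebner_basis J lt E (span two (free_alg Quot J) E (coset_vec J E ` X))
    (dehom_vec E ` htau ` G)"
proof -
  let ?N = "span two (free_alg Quot Jw) E (coset_vec Jw E ` homog_vec w E ` X)"
  let ?M = "span two (free_alg Quot J) E (coset_vec J E ` X)"
  let ?H = "dehom_vec E ` htau ` G"
  note ideal_J = ideal_PBW_ideal[of c d I] and ideal_Jw = ideal_hom_ideal[of c d I w]
  have finite_G: "finite G" and GN: "G \<subseteq> ?N" using gb by (auto simp: groebner_basis_def)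
  have "\<exists>k. \<forall>e\<in>E. homogeneous (hweight w) k (htau g e)" if "g \<in> G" for g
    using hom[OF that] unfolding homogeneous_vec_def
    by (force simp: htau_coset_vec intro: homogeneous_nf)
  then obtain k where k: "\<And>g e. g \<in> G \<Longrightarrow> e \<in> E \<Longrightarrow> homogeneous (hweight w) (k g) (htau g e)"
    by metis
  have coset_g: "coset_vec Jw E (htau g) = g" and std_g: "\<And>e. e \<in> E \<Longrightarrow> htau g e \<in> std_polys"
    if g: "g \<in> G" for g
  proof -
    obtain t where "g = coset_vec Jw E t"
      using hom[OF g] by (auto simp: homogeneous_vec_def)
    then show "coset_vec Jw E (htau g) = g" "\<And>e. e \<in> E \<Longrightarrow> htau g e \<in> std_polys"
      by (simp_all add: coset_vec_htau htau_coset_vec nf_coset(1))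
  qed
  have dv: "dehom_vec E t e = dehom (t e)" if "e \<in> E" for t e
    using that by (simp add: dehom_vec_def)
  have "?H \<subseteq> E \<rightarrow>\<^sub>E std_polys"
    by (auto simp: dehom_vec_def intro!: std_dehom std_g)
  moreover have "coset_vec J E (dehom_vec E (htau g)) \<in> ?M" if g: "g \<in> G" for g
  proof -
    have "htau g \<in> rep_span two Jw E (homog_vec w E ` X)"
      using GN g coset_g[OF g] by (auto simp flip: coset_vec_mem_span_iff[OF ideal_Jw])
    then have "coset_vec J E (\<lambda>e. dehom (htau g e)) \<in> ?M"
      unfolding coset_vec_mem_span_iff[OF ideal_J] by (rule dehom_rep_span)
    moreover have "coset_vec J E (dehom_vec E (htau g)) = coset_vec J E (\<lambda>e. dehom (htau g e))"
      by (simp add: coset_vec_eq_iff[OF ideal_J] dv ideal_0[OF ideal_J])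
    ultimately show ?thesis by simp
  qed
  moreover have "\<exists>a\<in>?H \<rightarrow> std_polys.
      coset_vec J E t = finsum (quot_module J E)
        (\<lambda>h. coset J (a h) \<odot>\<^bsub>quot_module J E\<^esub> coset_vec J E h) ?H \<and>
      (\<forall>h\<in>?H. lec_le lt (shift (lexp (comp_order lt (lcomp lt E h)) (a h)) (lec lt E h))
        (lec lt E t))"
    if t: "t \<in> E \<rightarrow>\<^sub>E std_polys" "coset_vec J E t \<in> ?M" for t
  proof -
    have "t \<in> rep_span two J E X" using t(2) by (simp add: coset_vec_mem_span_iff[OF ideal_J])
    then obtain D0 where D0: "\<And>D. D \<ge> D0 \<Longrightarrow>
        (\<lambda>e. homog_to w D (t e)) \<in> rep_span two Jw E (homog_vec w E ` X)"
      using homog_rep_span by blast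
    define D where "D = max D0 (mdeg w E t)"
    define s where "s = (\<lambda>e. homog_to w D (t e))"
    have s_std: "s e \<in> std_polys" if "e \<in> E" for e
      using t(1) that by (auto simp: s_def intro: std_homog_to)
    have s_hom: "homogeneous (hweight w) D (s e)" if "e \<in> E" for e
      unfolding s_def using wdeg_le_mdeg[OF finite_E that, of _ t w]
      by (intro homogeneous_homog_to) (force simp: D_def)
    have "coset_vec Jw E s \<in> ?N"
      unfolding coset_vec_mem_span_iff[OF ideal_Jw] s_def by (rule D0) (simp add: D_def)
    then obtain a where a: "a \<in> G \<rightarrow> carrier (free_alg Quot Jw)"
      "coset_vec Jw E s = finsum (quot_module Jw E) (\<lambda>g. a g \<odot>\<^bsub>quot_module Jw E\<^esub> g) G"
      and le: "\<And>g. g \<in> G \<Longrightarrow> lec_le ltw (shift (lexp (comp_order ltw (lcomp ltw E (htau g)))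
          (hnf (lcomp ltw E (htau g)) (a g))) (lec ltw E (htau g)))
          (lec ltw E (htau (coset_vec Jw E s)))"
      using gb unfolding groebner_basis_def Let_def by blast
    (* If g = 0 its leading component is arbitrary and the normal form of a_g is meaningless. *)
    define b where "b = (\<lambda>g. if msupp E (htau g) = {} then 0
      else hnf (lcomp ltw E (htau g)) (a g))"
    have b: "b g \<in> std_polys \<and> a g \<odot>\<^bsub>quot_module Jw E\<^esub> g =
        coset Jw (b g) \<odot>\<^bsub>quot_module Jw E\<^esub> coset_vec Jw E (htau g)" if g: "g \<in> G" for g
    proof -
      obtain p where p: "a g = coset Jw p" using a(1) g by (auto simp: carrier_Quot)
      show ?thesis
      proof (cases "msupp E (htau g) = {}")
        case True
        then have "supp (htau g e) = {}" if "e \<in> E" for e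
          using that by (fastforce simp: msupp_def)
        then have "htau g e = 0" if "e \<in> E" for e
          using that std_g[OF g] supp_empty by blast
        then have "coset_vec Jw E (\<lambda>e. p * htau g e) = coset_vec Jw E (\<lambda>e. b g * htau g e)"
          by (simp add: coset_vec_eq_iff[OF ideal_Jw] ideal_0[OF ideal_Jw])
        then show ?thesis
          using coset_g[OF g] quot_module_simps(3)[OF ideal_Jw, of E p "htau g"]
            quot_module_simps(3)[OF ideal_Jw, of E "b g" "htau g"]
          by (simp add: p b_def True)
      next
        case False
        then obtain x where x: "lec ltw E (htau g) = Some x"
          by (cases "lec ltw E (htau g)") (auto simp: lec_eq_None)
        then have "x \<in> msupp E (htau g)" by (simp add: lec_eq_Some[OF mmow finite_E])
        then have e: "lcomp ltw E (htau g) \<in> E" using x by (auto simp: lcomp_def msupp_def)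
        have "coset Jw (b g) = a g"
          using ideal_uminus[OF ideal_Jw nf_coset(2)[OF e, of p]]
          by (simp add: b_def False p coset_eq_iff[OF ideal_Jw])
        moreover have "b g \<in> std_polys" using nf_coset(1)[OF e] by (simp add: b_def False p)
        ultimately show ?thesis using coset_g[OF g] by simp
      qed
    qed
    interpret Mw: abelian_group "quot_module Jw E" by (rule abelian_group_quot_module[OF ideal_Jw])
    have "coset_vec Jw E s = finsum (quot_module Jw E)
        (\<lambda>g. coset Jw (b g) \<odot>\<^bsub>quot_module Jw E\<^esub> coset_vec Jw E (htau g)) G"
      unfolding a(2) using b
      by (intro Mw.finsum_cong') (auto simp: quot_module_simps[OF ideal_Jw])
    also have "\<dots> = coset_vec Jw E (\<lambda>e. \<Sum>g\<in>G. b g * htau g e)"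
      by (rule finsum_quot_module[OF ideal_Jw finite_G])
    finally have s_eq: "s e - (\<Sum>g\<in>G. b g * htau g e) \<in> Jw" if "e \<in> E" for e
      using that by (simp add: coset_vec_eq_iff[OF ideal_Jw])
    (* Only the part of a_g that contributes to degree D is kept. *)
    define b' where "b' = (\<lambda>g. if k g \<le> D then hcomp (hweight w) (D - k g) (b g) else 0)"
    have b'_std: "dehom (b' g) \<in> std_polys" if "g \<in> G" for g
      using b[OF that] by (simp add: b'_def std_dehom std_hcomp)
    have t_eq: "t e - (\<Sum>g\<in>G. dehom (b' g) * dehom (htau g e)) \<in> J" if e: "e \<in> E" for e
    proof -
      have *: "hcomp (hweight w) D (b g * htau g e) = b' g * htau g e" if "g \<in> G" for g
        by (simp add: hcomp_mult_homogeneous[OF k[OF that e]] b'_def)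
      have "hcomp (hweight w) D (s e - (\<Sum>g\<in>G. b g * htau g e)) = s e - (\<Sum>g\<in>G. b' g * htau g e)"
        by (simp add: hcomp_diff hcomp_sum hcomp_homogeneous[OF s_hom[OF e]] *)
      then have "s e - (\<Sum>g\<in>G. b' g * htau g e) \<in> Jw"
        using hcomp_mem_hom_ideal[OF s_eq[OF e], of D] by (simp only:)
      from dehom_mem_PBW_ideal[OF this] show ?thesis
        by (simp add: dehom_mult s_def)
    qed
    define a' where "a' h = (\<Sum>g\<in>{g. g \<in> G \<and> dehom_vec E (htau g) = h}. dehom (b' g))" for h
    have a'_std: "a' h \<in> std_polys" for h
      unfolding a'_def using b'_std by (intro std_sum) auto
    have "(\<Sum>h\<in>?H. a' h * h e) = (\<Sum>g\<in>G. dehom (b' g) * dehom (htau g e))" if "e \<in> E" for e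
    proof -
      have "(\<Sum>g\<in>G. dehom (b' g) * dehom (htau g e)) =
          (\<Sum>h\<in>(\<lambda>g. dehom_vec E (htau g)) ` G.
            \<Sum>g\<in>{g. g \<in> G \<and> dehom_vec E (htau g) = h}. dehom (b' g) * dehom (htau g e))"
        by (rule sum.image_gen[OF finite_G])
      also have "\<dots> = (\<Sum>h\<in>(\<lambda>g. dehom_vec E (htau g)) ` G. a' h * h e)"
        unfolding a'_def sum_distrib_right
        by (intro sum.cong refl) (auto simp: dv[OF that])
      finally show ?thesis by (simp add: image_image)
    qed
    then have "coset_vec J E t = coset_vec J E (\<lambda>e. \<Sum>h\<in>?H. a' h * h e)"
      using t_eq by (simp add: coset_vec_eq_iff[OF ideal_J])
    also have "\<dots> = finsum (quot_module J E)
        (\<lambda>h. coset J (a' h) \<odot>\<^bsub>quot_module J E\<^esub> coset_vec J E h) ?H"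
      by (rule finsum_quot_module[OF ideal_J, symmetric]) (simp add: finite_G)
    finally have sum: "coset_vec J E t = finsum (quot_module J E)
        (\<lambda>h. coset J (a' h) \<odot>\<^bsub>quot_module J E\<^esub> coset_vec J E h) ?H" .
    have "\<exists>y\<in>msupp E t. (\<gamma> + \<delta>, e) = y \<or> lt (\<gamma> + \<delta>, e) y"
      if h: "h \<in> ?H" and \<gamma>: "\<gamma> \<in> supp (a' h)" and \<delta>: "(\<delta>, e) \<in> msupp E h" for h \<gamma> \<delta> e
    proof -
      obtain g where g: "g \<in> G" "dehom_vec E (htau g) = h" "\<gamma> \<in> supp (dehom (b' g))"
        using \<gamma> supp_sum[of "\<lambda>g. dehom (b' g)" "{g. g \<in> G \<and> dehom_vec E (htau g) = h}"]
        unfolding a'_def by auto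
      have kD: "k g \<le> D" using g(3) by (auto simp: b'_def split: if_splits)
      obtain \<gamma>' where \<gamma>': "\<gamma> = dexpo \<gamma>'" "\<gamma>' \<in> supp (b g)" "hdeg w \<gamma>' = D - k g"
        using g(3) supp_dehom[OF std_hcomp[of "b g" "hweight w" "D - k g"]] b[OF g(1)] kD
        by (auto simp: b'_def supp_hcomp wdeg_std_word)
      have e: "e \<in> E" using \<delta> by (simp add: mem_msupp)
      obtain \<delta>' where \<delta>': "\<delta> = dexpo \<delta>'" "\<delta>' \<in> supp (htau g e)"
        using \<delta> g(2) supp_dehom[OF std_g[OF g(1) e]] by (auto simp: mem_msupp dv)
      have \<delta>'': "(\<delta>', e) \<in> msupp E (htau g)" using \<delta>'(2) e by (simp add: mem_msupp)
      then have "b g = hnf (lcomp ltw E (htau g)) (a g)" by (auto simp: b_def)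
      then obtain \<epsilon> e1 where \<epsilon>: "(\<epsilon>, e1) \<in> msupp E (htau (coset_vec Jw E s))"
        "(\<gamma>' + \<delta>', e) = (\<epsilon>, e1) \<or> ltw (\<gamma>' + \<delta>', e) (\<epsilon>, e1)"
        using le[OF g(1)] \<gamma>'(2) \<delta>'' unfolding lec_le_shift_iff[OF mmow finite_E] by fastforce
      then have e1: "e1 \<in> E" by (simp add: mem_msupp)
      then have "\<epsilon> \<in> supp (hnf e1 (coset Jw (s e1)))"
        using \<epsilon>(1) by (simp add: mem_msupp flip: htau_coset_vec)
      then obtain \<zeta> where \<zeta>: "\<zeta> \<in> supp (s e1)" "(\<epsilon>, e1) = (\<zeta>, e1) \<or> ltw (\<epsilon>, e1) (\<zeta>, e1)"
        using nf_dominated[OF e1 s_std[OF e1]] unfolding comp_order_def by blast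
      have "(\<gamma>' + \<delta>', e) = (\<zeta>, e1) \<or> ltw (\<gamma>' + \<delta>', e) (\<zeta>, e1)"
        by (rule ltw_trans[OF \<epsilon>(2) \<zeta>(2)]) (simp_all add: e e1)
      moreover have "hdeg w (\<gamma>' + \<delta>') = D"
        using kD \<gamma>'(3) hdeg_supp[OF k[OF g(1) e] \<delta>'(2)] by (simp add: hdeg_add)
      moreover have "hdeg w \<zeta> = D" by (rule hdeg_supp[OF s_hom[OF e1] \<zeta>(1)])
      ultimately have "(\<gamma> + \<delta>, e) = (dexpo \<zeta>, e1) \<or> lt (\<gamma> + \<delta>, e) (dexpo \<zeta>, e1)"
        by (auto simp: hom_order_iff \<gamma>'(1) \<delta>'(1) dexpo_add)
      moreover have "dexpo \<zeta> \<in> supp (t e1)"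
        using supp_homog_to[of "t e1" \<zeta> w D] \<zeta>(1) t(1) e1 by (auto simp: s_def)
      then have "(dexpo \<zeta>, e1) \<in> msupp E t" using e1 by (simp add: mem_msupp)
      ultimately show ?thesis by blast
    qed
    then have "\<forall>h\<in>?H. lec_le lt (shift (lexp (comp_order lt (lcomp lt E h)) (a' h)) (lec lt E h))
        (lec lt E t)"
      unfolding lec_le_shift_iff[OF mmo finite_E] by blast
    then show ?thesis using sum a'_std by blast
  qed
  ultimately show ?thesis
    using finite_G unfolding induces_groebner_basis_def by blast
qed

end

theorem proposition2p16:
  fixes c :: "'v::{finite,linorder} \<Rightarrow> 'v \<Rightarrow> 'k::field"
    and d :: "'v \<Rightarrow> 'v \<Rightarrow> ('v, 'k) ncpoly"
    and I :: "('v, 'k) ncpoly set"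
    and prec :: "'v expo \<Rightarrow> 'v expo \<Rightarrow> bool"
    and w :: "'v \<Rightarrow> nat"
    and E :: "'e set"
    and precE :: "'v expo \<times> 'e \<Rightarrow> 'v expo \<times> 'e \<Rightarrow> bool"
    and M' :: "('e \<Rightarrow> ('v, 'k) ncpoly) set"
  defines "J \<equiv> PBW_ideal c d I"
    and "A \<equiv> free_alg Quot PBW_ideal c d I"
    and "Jw \<equiv> hom_ideal c d I w"
    and "Aw \<equiv> free_alg Quot hom_ideal c d I w"
    and "precEw \<equiv> hom_order w precE"
    and "Iw \<equiv> hom_basis c d I w precE"
  assumes "PBW_datum c d I prec"
    and "\<And>i. w i > 0"
    and "weight_vector w d"
    and "finite E"
    and "ordering_on_module c d E precE"
    and "finite M'"
    and "M' \<subseteq> (E \<rightarrow>\<^sub>E std_polys)"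
  shows
    "(\<forall>G. groebner_basis Jw Iw precEw E
             (left_span Aw E (coset_vec Jw E ` homog_vec w E ` M')) G \<and>
          (\<forall>g\<in>G. homogeneous_vec (hweight w) Jw E g) \<longrightarrow>
        induces_groebner_basis J precE E (left_span A E (coset_vec J E ` M'))
          (dehom_vec E ` tau Jw Iw precEw E ` G)) \<and>
     (\<forall>G. groebner_basis Jw Iw precEw E
             (two_sided_span Aw E (coset_vec Jw E ` homog_vec w E ` M')) G \<and>
          (\<forall>g\<in>G. homogeneous_vec (hweight w) Jw E g) \<longrightarrow>
        induces_groebner_basis J precE E (two_sided_span A E (coset_vec J E ` M'))
          (dehom_vec E ` tau Jw Iw precEw E ` G))"
proof -
  interpret homogenized_algebra c d I w E precE
    using assms by unfold_locales auto
  have left: "left_span = span False" and two_sided: "two_sided_span = span True"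
    by (simp_all add: fun_eq_iff span_def)
  show ?thesis
    unfolding J_def A_def Jw_def Aw_def precEw_def Iw_def left two_sided
    using dehom_induces_groebner_basis by blast
qed

end
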